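(* Let $\mathcal{I}(\mathbf{z})$ and $\mathcal{I}^\delta(\mathbf{z})$ be the imaging functionals corresponding to exact and noisy data, respectively, i.e. $$\mathcal{I}(\mathbf{z}) := \sum_{m=1}^M\sum_{j=1}^N \left| \int_{\partial\Omega} \Big( [\nu\times\mathrm{curl}_{\mathbf{x}}(\mathrm{Im}\,\mathbb{G}(\mathbf{x},\mathbf{z})\mathbf{p}_m)]\cdot\mathbf{u}(\mathbf{x},\mathbf{d}_j) - \mathrm{Im}\,\mathbb{G}(\mathbf{x},\mathbf{z})\mathbf{p}_m\cdot[\nu\times\mathrm{curl}\,\mathbf{u}(\mathbf{x},\mathbf{d}_j)]\Big)\,\mathrm{d}s(\mathbf{x})\right|^p ,$$ $$\mathcal{I}^\delta(\mathbf{z}) := \sum_{m=1}^M\sum_{j=1}^N \left| \int_{\partial\Omega} \Big( [\nu\times\mathrm{curl}_{\mathbf{x}}(\mathrm{Im}\,\mathbb{G}(\mathbf{x},\mathbf{z})\mathbf{p}_m)]\cdot\mathbf{u}^\delta(\mathbf{x},\mathbf{d}_j) - \mathrm{Im}\,\mathbb{G}(\mathbf{x},\mathbf{z})\mathbf{p}_m\cdot[\nu\times\mathrm{curl}\,\mathbf{u}^\delta(\mathbf{x},\mathbf{d}_j)]\Big)\,\mathrm{d}s(\mathbf{x})\right|^p ,$$ where the noisy data satisfy, for positive constants $\delta_1,\delta_2$, $$\sum_{j=1}^N\|\mathbf{u}(\cdot,\mathbf{d}_j)-\mathbf{u}^\delta(\cdot,\mathbf{d}_j)\|_{(L^2(\partial\Omega))^3}\le\delta_1,\qquad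 \sum_{j=1}^N\|\nu\times\mathrm{curl}\,\mathbf{u}(\cdot,\mathbf{d}_j)-\nu\times\mathrm{curl}\,\mathbf{u}^\delta(\cdot,\mathbf{d}_j)\|_{(L^2(\partial\Omega))^3}\le\delta_2 .$$ Then for all $\mathbf{z}\in\mathbb{R}^3$, $$|\mathcal{I}(\mathbf{z})-\mathcal{I}^\delta(\mathbf{z})| = O(\max\{\delta_1,\delta_2\})\quad\text{as }\max\{\delta_1,\delta_2\}\to0 .$$
   Context: Let $k>0$ (wave number). Let $D\subset\mathbb{R}^3$ be a bounded domain, $\varepsilon$ a bounded $3\times3$ matrix-valued function on $\mathbb{R}^3$ (electric permittivity) with $\varepsilon=I_3$ outside $D$, and $P:=\varepsilon-I_3$ (so $P=0$ in $\mathbb{R}^3\setminus\overline{D}$). Let $\mathbb{S}^2$ be the unit sphere in $\mathbb{R}^3$. Incident fields: for $j=1,\dots,N$, $\mathbf{E}_{\mathrm{in}}(\mathbf{x},\mathbf{d}_j)=\mathbf{q}_je^{ik\mathbf{d}_j\cdot\mathbf{x}}$ with $\mathbf{d}_j\in\mathbb{S}^2$ and $\mathbf{q}_j\in\mathbb{R}^3$ orthogonal to $\mathbf{d}_j$. The scattered electric field $\mathbf{u}=\mathbf{u}(\cdot,\mathbf{d}_j)$ is the (weak, in $H_{\mathrm{loc}}(\mathrm{curl},\mathbb{R}^3)$) solution of $$\mathrm{curl}\,\mathrm{curl}\,\mathbf{u}-k^2\varepsilon\mathbf{u}=k^2P\,\mathbf{E}_{\mathrm{in}}\quad\text{in }\mathbb{R}^3$$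 satisfying the Silver–Müller radiation condition $\mathrm{curl}\,\mathbf{u}\times\frac{\mathbf{x}}{|\mathbf{x}|}-ik\mathbf{u}=O(|\mathbf{x}|^{-2})$ as $|\mathbf{x}|\to\infty$, uniformly in $\mathbf{x}/|\mathbf{x}|$. Standing assumption: this direct scattering problem is well-posed. $\Omega\subset\mathbb{R}^3$ is a regular domain (bounded, with boundary smooth enough for the divergence theorem) with $\overline{D}\subset\Omega$, and $\nu$ is the outward unit normal on $\partial\Omega$. Vectors $\mathbf{p}_1,\dots,\mathbf{p}_M\in\mathbb{S}^2$ are given and $p\in\mathbb{N}=\{1,2,\dots\}$ is fixed. The Green's tensor is $$\mathbb{G}(\mathbf{x},\mathbf{y})=\Phi(\mathbf{x},\mathbf{y})I_3+\frac1{k^2}\nabla_{\mathbf{x}}\mathrm{div}_{\mathbf{x}}(\Phi(\mathbf{x},\mathbf{y})I_3),\quad \mathbf{x}\ne\mathbf{y},\qquad \Phi(\mathbf{x},\mathbf{y})=\frac{e^{ik|\mathbf{x}-\mathbf{y}|}}{4\pi|\mathbf{x}-\mathbf{y}|},$$ with the divergence taken columnwise, so that $\mathbb{G}(\mathbf{x},\mathbf{y})\mathbf{p}=\Phi(\mathbf{x},\mathbf{y})\mathbf{p}+\frac1{k^2}\nabla_{\mathbf{x}}\mathrm{div}_{\mathbf{x}}(\Phi(\mathbf{x},\mathbf{y})\mathbf{p})$ for constant vectors $\mathbf{p}$. $\mathrm{Im}\,\mathbb{G}$ is its entrywise imaginary part, which extends smoothly to all $\mathbf{x},\mathbf{y}$.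 The dot denotes the bilinear product $\mathbf{a}\cdot\mathbf{b}=\sum_l a_lb_l$ (no complex conjugation). The noisy data $\mathbf{u}^\delta(\cdot,\mathbf{d}_j)$ and $\nu\times\mathrm{curl}\,\mathbf{u}^\delta(\cdot,\mathbf{d}_j)$ are complex vector-valued functions in $(L^2(\partial\Omega))^3$ (perturbed measurements; the second is just the notation for the noisy version of the data $\nu\times\mathrm{curl}\,\mathbf{u}$). The constant in the $O(\cdot)$ may depend on $\mathbf{z}$ and on the exact problem data, but not on the noisy data or on $\delta_1,\delta_2$. *)

theory Defs
  imports "HOL-Analysis.Analysis" "HOL-Library.Landau_Symbols"
begin

section \<open>Vector calculus for real and complex fields on three-space\<close>

text \<open>The dot product of complex vectors is the bilinear \<open>scalar_product\<close>; the inner product on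
  \<open>complex^3\<close> is real-valued.\<close>

definition cvec :: "real^3 \<Rightarrow> complex^3" where
  "cvec v = (\<chi> i. complex_of_real (v $ i))"

definition ccross :: "complex^3 \<Rightarrow> complex^3 \<Rightarrow> complex^3" where
  "ccross a b = vector [a$2 * b$3 - a$3 * b$2, a$3 * b$1 - a$1 * b$3, a$1 * b$2 - a$2 * b$1]"

definition partial :: "3 \<Rightarrow> (real^3 \<Rightarrow> 'b::real_normed_vector) \<Rightarrow> real^3 \<Rightarrow> 'b" where
  "partial i f x = frechet_derivative f (at x) (axis i 1)"

definition div3 :: "(real^3 \<Rightarrow> 'a::real_normed_field^3) \<Rightarrow> real^3 \<Rightarrow> 'a" where
  "div3 F x = (\<Sum>i\<in>UNIV. partial i (\<lambda>y. F y $ i) x)"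

definition curl :: "(real^3 \<Rightarrow> 'a::real_normed_field^3) \<Rightarrow> real^3 \<Rightarrow> 'a^3" where
  "curl F x = vector
     [partial 2 (\<lambda>y. F y $ 3) x - partial 3 (\<lambda>y. F y $ 2) x,
      partial 3 (\<lambda>y. F y $ 1) x - partial 1 (\<lambda>y. F y $ 3) x,
      partial 1 (\<lambda>y. F y $ 2) x - partial 2 (\<lambda>y. F y $ 1) x]"

text \<open>\<open>n\<close> times continuously differentiable on an open set \<open>S\<close>.\<close>

primrec C_on :: "nat \<Rightarrow> (real^3) set \<Rightarrow> (real^3 \<Rightarrow> 'b::real_normed_vector) \<Rightarrow> bool" where
  "C_on 0 S f \<longleftrightarrow> continuous_on S f"
| "C_on (Suc n) S f \<longleftrightarrow> f differentiable_on S \<and> (\<forall>i. C_on n S (partial i f))"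

definition test_field :: "(real^3 \<Rightarrow> complex^3) \<Rightarrow> bool" where
  "test_field \<phi> \<longleftrightarrow> (\<forall>n. C_on n UNIV \<phi>) \<and> bounded {x. \<phi> x \<noteq> 0}"

section \<open>Square-integrable fields and the weak curl\<close>

definition in_L2 :: "(real^3) measure \<Rightarrow> (real^3 \<Rightarrow> complex^3) \<Rightarrow> bool" where
  "in_L2 M f \<longleftrightarrow> f \<in> borel_measurable M \<and> integrable M (\<lambda>x. (norm (f x))\<^sup>2)"

definition L2_norm :: "(real^3) measure \<Rightarrow> (real^3 \<Rightarrow> complex^3) \<Rightarrow> real" where
  "L2_norm M f = sqrt (\<integral>x. (norm (f x))\<^sup>2 \<partial>M)"

definition in_L2_loc :: "(real^3 \<Rightarrow> complex^3) \<Rightarrow> bool" where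
  "in_L2_loc f \<longleftrightarrow> (\<forall>R>0. in_L2 (lebesgue_on (ball 0 R)) f)"

text \<open>\<open>u\<close> belongs to \<open>H\<^sub>l\<^sub>o\<^sub>c(curl)\<close>, and \<open>w\<close> represents its distributional curl.\<close>

definition has_weak_curl :: "(real^3 \<Rightarrow> complex^3) \<Rightarrow> (real^3 \<Rightarrow> complex^3) \<Rightarrow> bool" where
  "has_weak_curl u w \<longleftrightarrow> in_L2_loc u \<and> in_L2_loc w \<and>
     (\<forall>\<phi>. test_field \<phi> \<longrightarrow>
        (\<integral>x. scalar_product (u x) (curl \<phi> x) \<partial>lebesgue) = (\<integral>x. scalar_product (w x) (\<phi> x) \<partial>lebesgue))"

section \<open>The direct scattering problem\<close>

definition E_in :: "real \<Rightarrow> real^3 \<Rightarrow> real^3 \<Rightarrow> real^3 \<Rightarrow> complex^3" where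
  "E_in k q d x = exp (\<i> * of_real (k * (d \<bullet> x))) *s cvec q"

definition weak_maxwell ::
  "real \<Rightarrow> (real^3 \<Rightarrow> complex^3^3) \<Rightarrow> (real^3 \<Rightarrow> complex^3) \<Rightarrow> (real^3 \<Rightarrow> complex^3) \<Rightarrow> bool" where
  "weak_maxwell k \<epsilon> E u \<longleftrightarrow>
     (\<exists>w. has_weak_curl u w \<and>
        (\<forall>\<phi>. test_field \<phi> \<longrightarrow>
           (\<integral>x. scalar_product (w x) (curl \<phi> x) - of_real (k\<^sup>2) * scalar_product (\<epsilon> x *v u x) (\<phi> x) \<partial>lebesgue) =
           (\<integral>x. of_real (k\<^sup>2) * scalar_product ((\<epsilon> x - mat 1) *v E x) (\<phi> x) \<partial>lebesgue)))"

definition silver_mueller :: "real \<Rightarrow> (real^3 \<Rightarrow> complex^3) \<Rightarrow> bool" where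
  "silver_mueller k u \<longleftrightarrow>
     (\<lambda>x. norm (ccross (curl u x) (cvec (x /\<^sub>R norm x)) - (\<i> * of_real k) *s u x))
       \<in> O[at_infinity](\<lambda>x. 1 / (norm x)\<^sup>2)"

text \<open>Outside the closure of \<open>D\<close> a weak solution is smooth by elliptic regularity. Requiring
  \<open>C\<^sup>1\<close> there selects the continuous representative, so that the radiation condition and the
  boundary values of \<open>u\<close> and of its curl have their classical meaning.\<close>

definition scattered_field ::
  "real \<Rightarrow> (real^3) set \<Rightarrow> (real^3 \<Rightarrow> complex^3^3) \<Rightarrow> (real^3 \<Rightarrow> complex^3) \<Rightarrow> (real^3 \<Rightarrow> complex^3) \<Rightarrow> bool" where
  "scattered_field k D \<epsilon> E u \<longleftrightarrow>
     weak_maxwell k \<epsilon> E u \<and> C_on 1 (- closure D) u \<and> silver_mueller k u"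

text \<open>Well-posedness in the sense of Hadamard for plane-wave incidence: existence, uniqueness,
  and continuous dependence in \<open>H(curl)\<close> of every ball on the incident field in \<open>L\<^sup>2(D)\<close>. By
  linearity, continuous dependence is a Lipschitz estimate. It is implied by well-posedness for
  arbitrary sources in \<open>L\<^sup>2(D)\<close>.\<close>

definition admissible_wave :: "real^3 \<Rightarrow> real^3 \<Rightarrow> bool" where
  "admissible_wave q d \<longleftrightarrow> d \<in> sphere 0 1 \<and> q \<bullet> d = 0"

definition well_posed :: "real \<Rightarrow> (real^3) set \<Rightarrow> (real^3 \<Rightarrow> complex^3^3) \<Rightarrow> bool" where
  "well_posed k D \<epsilon> \<longleftrightarrow>
     (\<forall>q d. admissible_wave q d \<longrightarrow> (\<exists>u. scattered_field k D \<epsilon> (E_in k q d) u)) \<and>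
     (\<forall>q d u u'. admissible_wave q d \<and> scattered_field k D \<epsilon> (E_in k q d) u \<and>
        scattered_field k D \<epsilon> (E_in k q d) u' \<longrightarrow> (AE x in lebesgue. u x = u' x)) \<and>
     (\<forall>R>0. \<exists>C. \<forall>q d q' d' u u' w w'.
        admissible_wave q d \<and> scattered_field k D \<epsilon> (E_in k q d) u \<and> has_weak_curl u w \<and>
        admissible_wave q' d' \<and> scattered_field k D \<epsilon> (E_in k q' d') u' \<and> has_weak_curl u' w' \<longrightarrow>
        sqrt ((L2_norm (lebesgue_on (ball 0 R)) (\<lambda>x. u x - u' x))\<^sup>2 +
              (L2_norm (lebesgue_on (ball 0 R)) (\<lambda>x. w x - w' x))\<^sup>2)
          \<le> C * L2_norm (lebesgue_on D) (\<lambda>x. E_in k q d x - E_in k q' d' x))"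

section \<open>Regular domains, outward normal, surface measure\<close>

definition bounded_domain :: "(real^3) set \<Rightarrow> bool" where
  "bounded_domain S \<longleftrightarrow> open S \<and> connected S \<and> S \<noteq> {} \<and> bounded S"

text \<open>Bounded domains with Lipschitz boundary; this includes all bounded \<open>C\<^sup>1\<close> domains. Near
  each boundary point, and with respect to some direction \<open>e\<close>, the domain lies below the graph of
  a function \<open>g\<close> of the component orthogonal to \<open>e\<close>.\<close>

definition regular_domain :: "(real^3) set \<Rightarrow> bool" where
  "regular_domain S \<longleftrightarrow> bounded_domain S \<and>
     (\<forall>x\<in>frontier S. \<exists>e r L. \<exists>g :: real^3 \<Rightarrow> real.
        norm e = 1 \<and> r > 0 \<and> L-lipschitz_on UNIV g \<and>
        S \<inter> ball x r = {y \<in> ball x r. y \<bullet> e < g (y - (y \<bullet> e) *\<^sub>R e)})"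

text \<open>The outward unit normal through the tangent half-space: close to \<open>x\<close>, the set contains
  every cone strictly inside the half-space opposite to \<open>n\<close> and avoids every cone strictly on the
  side of \<open>n\<close>. On a \<open>C\<^sup>1\<close> boundary it exists everywhere, on a Lipschitz boundary almost
  everywhere (Rademacher).\<close>

definition is_outward_normal :: "(real^3) set \<Rightarrow> real^3 \<Rightarrow> real^3 \<Rightarrow> bool" where
  "is_outward_normal S x n \<longleftrightarrow> x \<in> frontier S \<and> norm n = 1 \<and>
     (\<forall>\<eta>>0. \<exists>r>0. \<forall>y\<in>ball x r.
        ((y - x) \<bullet> n > \<eta> * norm (y - x) \<longrightarrow> y \<notin> S) \<and>
        ((y - x) \<bullet> n < - \<eta> * norm (y - x) \<longrightarrow> y \<in> S))"

definition outward_normal :: "(real^3) set \<Rightarrow> real^3 \<Rightarrow> real^3" where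
  "outward_normal S x =
     (if \<exists>n. is_outward_normal S x n then THE n. is_outward_normal S x n else 0)"

text \<open>Surface measure is two-dimensional Hausdorff measure, with the factor \<open>\<pi>/4\<close> that makes it
  agree with surface area. Being a metric outer measure, \<open>hausdorff2_outer\<close> is countably additive
  on Borel sets, so the degenerate case of \<open>measure_of\<close> does not arise.\<close>

definition hausdorff2_pre :: "real \<Rightarrow> (real^3) set \<Rightarrow> ennreal" where
  "hausdorff2_pre r A =
     (INF U \<in> {U :: nat \<Rightarrow> (real^3) set. A \<subseteq> (\<Union>i. U i) \<and> (\<forall>i. bounded (U i) \<and> diameter (U i) \<le> r)}.
        \<Sum>i. ennreal (pi / 4 * (diameter (U i))\<^sup>2))"

definition hausdorff2_outer :: "(real^3) set \<Rightarrow> ennreal" where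
  "hausdorff2_outer A = (SUP r \<in> {0<..}. hausdorff2_pre r A)"

definition hausdorff2 :: "(real^3) measure" where
  "hausdorff2 = measure_of UNIV (sets borel) hausdorff2_outer"

definition surface_measure :: "(real^3) set \<Rightarrow> (real^3) measure" where
  "surface_measure S = restrict_space hausdorff2 (frontier S)"

section \<open>Green's tensor and the imaging functional\<close>

definition Phi :: "real \<Rightarrow> real^3 \<Rightarrow> real^3 \<Rightarrow> complex" where
  "Phi k x y = exp (\<i> * of_real (k * norm (x - y))) / of_real (4 * pi * norm (x - y))"

definition green :: "real \<Rightarrow> real^3 \<Rightarrow> real^3 \<Rightarrow> complex^3^3" where
  "green k x y = (\<chi> i j. mat (Phi k x y) $ i $ j +
     1 / of_real (k\<^sup>2) *
       partial i (\<lambda>x'. div3 (\<lambda>x''. column j (mat (Phi k x'' y) :: complex^3^3)) x') x)"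

text \<open>The entrywise imaginary part, extended continuously (in fact smoothly) to the diagonal.\<close>

definition Im_green :: "real \<Rightarrow> real^3 \<Rightarrow> real^3 \<Rightarrow> real^3^3" where
  "Im_green k x y =
     (let A = (\<lambda>x'. \<chi> i j. Im (green k x' y $ i $ j)) in if x = y then Lim (at y) A else A x)"

definition boundary_pairing ::
  "real \<Rightarrow> (real^3) set \<Rightarrow> real^3 \<Rightarrow> (real^3 \<Rightarrow> complex^3) \<Rightarrow> (real^3 \<Rightarrow> complex^3) \<Rightarrow> real^3 \<Rightarrow> complex" where
  "boundary_pairing k \<Omega> a v w z =
     (\<integral>x. scalar_product (cvec (cross3 (outward_normal \<Omega> x) (curl (\<lambda>x'. Im_green k x' z *v a) x))) (v x)
           - scalar_product (cvec (Im_green k x z *v a)) (w x) \<partial>surface_measure \<Omega>)"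

text \<open>In \<open>imaging\<close>, \<open>v j\<close> is the field and \<open>w j\<close> the tangential trace of its curl for the
  \<open>j\<close>-th incident wave.\<close>

definition imaging ::
  "real \<Rightarrow> (real^3) set \<Rightarrow> nat \<Rightarrow> nat \<Rightarrow> (nat \<Rightarrow> real^3) \<Rightarrow> nat \<Rightarrow>
   (nat \<Rightarrow> real^3 \<Rightarrow> complex^3) \<Rightarrow> (nat \<Rightarrow> real^3 \<Rightarrow> complex^3) \<Rightarrow> real^3 \<Rightarrow> real" where
  "imaging k \<Omega> M N pol p v w z =
     (\<Sum>m=1..M. \<Sum>j=1..N. cmod (boundary_pairing k \<Omega> (pol m) (v j) (w j) z) ^ p)"

definition curl_trace :: "(real^3) set \<Rightarrow> (real^3 \<Rightarrow> complex^3) \<Rightarrow> real^3 \<Rightarrow> complex^3" where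
  "curl_trace \<Omega> u x = ccross (cvec (outward_normal \<Omega> x)) (curl u x)"

end

theory Submission
  imports Defs "HOL-Complex_Analysis.Cauchy_Integral_Formula"
begin

text \<open>For fixed \<open>z\<close> and polarisation \<open>a\<close>, the integral over \<open>\<partial>\<Omega>\<close> inside the imaging functional
  is a linear functional of the pair \<open>(v, w)\<close> of boundary data, with kernels
  \<open>\<nu> \<times> curl (Im G(\<cdot>, z) a)\<close> and \<open>Im G(\<cdot>, z) a\<close>. If both kernels are bounded and Borel measurable on
  \<open>\<partial>\<Omega>\<close>, and \<open>\<partial>\<Omega>\<close> has finite area, the Cauchy-Schwarz inequality makes this functional Lipschitz in
  the \<open>L\<^sup>2\<close>-norm, with a constant that depends on \<open>z\<close>, \<open>a\<close>, \<open>k\<close> and \<open>\<Omega>\<close> alone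
  (\<open>boundary_pairing_lipschitz\<close>). Each exact integral is a fixed number, and by the Lipschitz estimate
  the noisy one stays in a fixed bounded set once the noise level is below \<open>1\<close>. On such a set
  \<open>t \<mapsto> t\<^sup>p\<close> is Lipschitz (\<open>abs_power_diff_le\<close>), and summing over \<open>m\<close> and \<open>j\<close> gives the claim.

  The work lies in the properties of the kernels and of the surface.

  \<^item> The singularity of \<open>G\<close> at \<open>z\<close> is entirely in its real part: \<open>Im \<Phi> = sin (k r) / (4 \<pi> r)\<close> is an entire
    function of \<open>r\<^sup>2\<close>. Differentiating twice, \<open>Im G(\<cdot>, z)\<close> is given by derivatives of that entire
    function, also at \<open>z\<close> (\<open>Im_green_smooth_formula\<close>). Hence its columns are \<open>C\<^sup>1\<close>, their curls are
    continuous, and both are bounded on \<open>\<partial>\<Omega>\<close>, no matter where \<open>z\<close> lies.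

  \<^item> The normal is defined pointwise by cone conditions, so its measurability has to be extracted from
    that definition (\<open>borel_measurable_outward_normal\<close>). Each cone condition of given threshold and radius
    is closed in the pair (point, direction), and compactness of the sphere allows the direction to be
    projected away.

  \<^item> The boundary of a Lipschitz domain is covered by finitely many Lipschitz graphs. A grid in the plane
    orthogonal to the graph direction yields covers by sets of arbitrarily small diameter with
    bounded sum of squared diameters (\<open>finite_area_frontier\<close>).

  Finally \<open>\<partial>\<Omega>\<close> lies at positive distance from \<open>D\<close>, where the scattered field is \<open>C\<^sup>1\<close>. The exact
  data are therefore bounded and measurable on \<open>\<partial>\<Omega>\<close>, in particular square-integrable, which is what
  the Lipschitz estimate asks of them.\<close>

section \<open>The imaginary part of the Green tensor\<close>

text \<open>The sine series divided by \<open>4 \<pi> \<surd>t\<close> has only integer powers of \<open>t\<close>, so it is a power series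
  with infinite radius of convergence. It is presented through the sequence \<open>s\<close> of its successive
  derivatives, which are what the formula for \<open>Im G\<close> uses.\<close>

lemma sinc_kernel_entire:
  fixes k :: real
  shows "\<exists>s :: nat \<Rightarrow> real \<Rightarrow> real.
    (\<forall>n t. (s n has_real_derivative s (Suc n) t) (at t)) \<and>
    (\<forall>t>0. s 0 t = sin (k * sqrt t) / (4 * pi * sqrt t))"
proof -
  define a where "a n = (-1) ^ n / fact (2 * n + 1) * k ^ (2 * n + 1) / (4 * pi)" for n :: nat
  have sums: "(\<lambda>n. a n * t ^ n) sums (sin (k * sqrt t) / (4 * pi * sqrt t))" if "t > 0" for t
  proof -
    have "(\<lambda>n. (-1) ^ n / fact (2 * n + 1) * (k * sqrt t) ^ (2 * n + 1) / (4 * pi * sqrt t)) sums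
      (sin (k * sqrt t) / (4 * pi * sqrt t))"
      by (intro sums_divide sin_paired)
    moreover have "(-1) ^ n / fact (2 * n + 1) * (k * sqrt t) ^ (2 * n + 1) / (4 * pi * sqrt t) = a n * t ^ n" for n
    proof -
      have "(sqrt t) ^ (2 * n + 1) = t ^ n * sqrt t" using that by (simp add: power_mult)
      then show ?thesis using that by (simp add: a_def power_mult_distrib)
    qed
    ultimately show ?thesis by simp
  qed
  have sum0: "summable (\<lambda>n. a n * y ^ n)" for y
    by (rule powser_inside[of a "\<bar>y\<bar> + 1"]) (use sums[of "\<bar>y\<bar> + 1"] in \<open>auto simp: sums_iff\<close>)
  have summ: "summable (\<lambda>n. (diffs ^^ m) a n * y ^ n)" for m y
    by (induction m arbitrary: y) (auto intro: sum0 termdiff_converges_all)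
  define s where "s m t = (\<Sum>n. (diffs ^^ m) a n * t ^ n)" for m and t :: real
  have "(s m has_real_derivative s (Suc m) t) (at t)" for m t
    unfolding s_def using termdiffs_strong_converges_everywhere[OF summ, of m t] by simp
  moreover have "s 0 t = sin (k * sqrt t) / (4 * pi * sqrt t)" if "t > 0" for t
    using sums[OF that] by (simp add: s_def sums_iff)
  ultimately show ?thesis by blast
qed

lemma partial_eq:
  assumes "(f has_derivative f') (at x)"
  shows "partial i f x = f' (axis i 1)"
  using frechet_derivative_at[OF assms] by (simp add: partial_def)

lemma has_derivative_radial:
  fixes z :: "real^3"
  assumes "(f has_vector_derivative f') (at ((x - z) \<bullet> (x - z)))"
  shows "((\<lambda>x. f ((x - z) \<bullet> (x - z))) has_derivative (\<lambda>h. (2 * ((x - z) \<bullet> h)) *\<^sub>R f')) (at x)"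
proof -
  have "((\<lambda>x. (x - z) \<bullet> (x - z)) has_derivative (\<lambda>h. 2 * ((x - z) \<bullet> h))) (at x)"
    by (auto intro!: derivative_eq_intros simp: inner_commute)
  from has_derivative_compose[OF this, of f "\<lambda>h. h *\<^sub>R f'"] assms
  show ?thesis by (simp add: has_vector_derivative_def)
qed

text \<open>This holds at every \<open>x\<close>, the diagonal included: the divergence of a column of \<open>\<Phi> I\<close> has a single
  term that is not identically zero.\<close>

lemma green_eq_partial_partial_Phi:
  "green k x z $ i $ j = (if i = j then Phi k x z else 0) +
     1 / of_real (k\<^sup>2) * partial i (\<lambda>x. partial j (\<lambda>x. Phi k x z) x) x"
proof -
  have p0: "partial l (\<lambda>x. 0 :: complex) x = 0" for l x
  proof -
    have "((\<lambda>x. 0 :: complex) has_derivative (\<lambda>h. 0)) (at x)" by simp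
    from partial_eq[OF this] show ?thesis .
  qed
  have div: "div3 (\<lambda>y. column j (mat (Phi k y z) :: complex^3^3)) x = partial j (\<lambda>y. Phi k y z) x" for x
  proof -
    have "(\<lambda>y. column j (mat (Phi k y z) :: complex^3^3) $ l) = (if l = j then (\<lambda>y. Phi k y z) else (\<lambda>y. 0))" for l
      by (auto simp: column_def mat_def fun_eq_iff)
    then show ?thesis
      unfolding div3_def by (simp add: if_distrib[of "\<lambda>f. partial _ f x"] p0 cong: if_cong)
  qed
  show ?thesis unfolding green_def vec_lambda_beta div by (simp add: mat_def)
qed

text \<open>With \<open>\<Phi>\<close> written as \<open>F (r\<^sup>2)\<close>, the profile \<open>F\<close> is the restriction to the positive axis of a
  holomorphic function on the slit plane. This provides the two derivatives that enter \<open>G\<close>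
  without computing them.\<close>

lemma Phi_radial_profile:
  fixes k :: real
  shows "\<exists>F F1 F2 :: real \<Rightarrow> complex.
    (\<forall>t>0. (F has_vector_derivative F1 t) (at t)) \<and> (\<forall>t>0. (F1 has_vector_derivative F2 t) (at t)) \<and>
    (\<forall>t>0. F t = exp (\<i> * of_real (k * sqrt t)) / of_real (4 * pi * sqrt t))"
proof -
  define E where "E w = exp (\<i> * of_real k * csqrt w) / (of_real (4 * pi) * csqrt w)" for w
  define U where "U = - (\<real>\<^sub>\<le>\<^sub>0 :: complex set)"
  have U: "open U" by (auto simp: U_def)
  have tU: "of_real t \<in> U" if "t > 0" for t using that by (auto simp: U_def)
  have E: "E holomorphic_on U"
    unfolding E_def U_def by (intro holomorphic_intros) auto
  have E1: "deriv E holomorphic_on U" using E U by (rule holomorphic_deriv)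
  show ?thesis
  proof (rule exI[of _ "\<lambda>t. E (of_real t)"], rule exI[of _ "\<lambda>t. deriv E (of_real t)"],
      rule exI[of _ "\<lambda>t. deriv (deriv E) (of_real t)"], intro conjI allI impI)
    fix t :: real assume "t > 0"
    show "((\<lambda>t. E (of_real t)) has_vector_derivative deriv E (of_real t)) (at t)"
      by (intro has_vector_derivative_real_field holomorphic_derivI[OF E U tU] \<open>t > 0\<close>)
    show "((\<lambda>t. deriv E (of_real t)) has_vector_derivative deriv (deriv E) (of_real t)) (at t)"
      by (intro has_vector_derivative_real_field holomorphic_derivI[OF E1 U tU] \<open>t > 0\<close>)
    show "E (of_real t) = exp (\<i> * of_real (k * sqrt t)) / of_real (4 * pi * sqrt t)"
      using \<open>t > 0\<close> by (simp add: E_def mult.assoc flip: of_real_sqrt)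
  qed
qed

text \<open>Off the diagonal, \<open>\<partial>\<^sub>i \<partial>\<^sub>j F (r\<^sup>2) = 2 \<delta>\<^sub>i\<^sub>j F' + 4 r\<^sub>i r\<^sub>j F''\<close>, and the imaginary parts of \<open>F\<close>, \<open>F'\<close>, \<open>F''\<close> are
  the entire function of \<open>sinc_kernel_entire\<close> and its derivatives. The right-hand side is continuous
  everywhere, so it is also the value of the continuous extension on the diagonal.\<close>

lemma Im_green_smooth_formula:
  fixes k :: real and z :: "real^3"
  obtains s :: "nat \<Rightarrow> real \<Rightarrow> real" where
    "\<And>n t. (s n has_real_derivative s (Suc n) t) (at t)"
    "\<And>x i j. Im_green k x z $ i $ j =
       (if i = j then s 0 ((x - z) \<bullet> (x - z)) + 2 / k\<^sup>2 * s 1 ((x - z) \<bullet> (x - z)) else 0) +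
       4 / k\<^sup>2 * (x - z) $ i * (x - z) $ j * s 2 ((x - z) \<bullet> (x - z))"
proof -
  obtain s :: "nat \<Rightarrow> real \<Rightarrow> real" where s: "\<And>n t. (s n has_real_derivative s (Suc n) t) (at t)"
    "\<And>t. t > 0 \<Longrightarrow> s 0 t = sin (k * sqrt t) / (4 * pi * sqrt t)"
    using sinc_kernel_entire[of k] by blast
  obtain F F1 F2 :: "real \<Rightarrow> complex" where
    F: "\<And>t. t > 0 \<Longrightarrow> (F has_vector_derivative F1 t) (at t)"
       "\<And>t. t > 0 \<Longrightarrow> (F1 has_vector_derivative F2 t) (at t)"
       "\<And>t. t > 0 \<Longrightarrow> F t = exp (\<i> * of_real (k * sqrt t)) / of_real (4 * pi * sqrt t)"
    using Phi_radial_profile[of k] by blast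
  \<comment> \<open>Taking imaginary parts commutes with differentiation, so the identification passes from each profile to the next.\<close>
  have step: "Im (g' t) = s (Suc n) t"
    if "\<And>t. t > 0 \<Longrightarrow> (g has_vector_derivative g' t) (at t)" "\<And>t. t > 0 \<Longrightarrow> Im (g t) = s n t" "t > 0"
    for g g' n and t :: real
  proof -
    have "((\<lambda>t. Im (g t)) has_vector_derivative Im (g' t)) (at t)"
      using bounded_linear.has_vector_derivative[OF bounded_linear_Im that(1)[OF that(3)]] .
    then have "(s n has_vector_derivative Im (g' t)) (at t)"
      by (rule has_vector_derivative_transform_within_open[of _ _ _ "{0<..}"]) (use that in auto)
    then show ?thesis
      using s(1)[of n t] DERIV_unique has_real_derivative_iff_has_vector_derivative by blast
  qed
  have ImF: "Im (F t) = s 0 t" if "t > 0" for t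
    using that by (simp add: F(3) s(2) Im_exp Im_divide_of_real)
  have ImF1: "Im (F1 t) = s 1 t" if "t > 0" for t using step[OF F(1) ImF that] by simp
  have ImF2: "Im (F2 t) = s 2 t" if "t > 0" for t
    using step[OF F(2) ImF1 that] by (simp add: numeral_2_eq_2)
  define \<rho> where "\<rho> x = (x - z) \<bullet> (x - z)" for x
  have \<rho>: "\<rho> x > 0" if "x \<noteq> z" for x using that by (simp add: \<rho>_def)
  have Phi: "Phi k x z = F (\<rho> x)" if "x \<noteq> z" for x
    using F(3)[OF \<rho>[OF that]] by (simp add: Phi_def \<rho>_def norm_eq_sqrt_inner)
  have d1: "partial j (\<lambda>x. Phi k x z) x = (2 * (x - z) $ j) *\<^sub>R F1 (\<rho> x)" if "x \<noteq> z" for x j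
  proof -
    have "((\<lambda>x. F (\<rho> x)) has_derivative (\<lambda>h. (2 * ((x - z) \<bullet> h)) *\<^sub>R F1 (\<rho> x))) (at x)"
      using has_derivative_radial[of F _ x z] F(1)[OF \<rho>[OF that]] by (simp add: \<rho>_def)
    then have "((\<lambda>x. Phi k x z) has_derivative (\<lambda>h. (2 * ((x - z) \<bullet> h)) *\<^sub>R F1 (\<rho> x))) (at x)"
      by (rule has_derivative_transform_within_open[of _ _ _ _ "- {z}"]) (use that Phi in auto)
    from partial_eq[OF this] show ?thesis by (simp add: inner_axis)
  qed
  have d2: "partial i (\<lambda>x. partial j (\<lambda>x. Phi k x z) x) x =
      (2 * (axis i 1 :: real^3) $ j) *\<^sub>R F1 (\<rho> x) + (4 * (x - z) $ i * (x - z) $ j) *\<^sub>R F2 (\<rho> x)"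
    if "x \<noteq> z" for x i j
  proof -
    have r: "((\<lambda>x. F1 (\<rho> x)) has_derivative (\<lambda>h. (2 * ((x - z) \<bullet> h)) *\<^sub>R F2 (\<rho> x))) (at x)"
      using has_derivative_radial[of F1 _ x z] F(2)[OF \<rho>[OF that]] by (simp add: \<rho>_def)
    have l: "((\<lambda>x. 2 * (x - z) $ j) has_derivative (\<lambda>h. 2 * h $ j)) (at x)"
    proof -
      have "((\<lambda>x. (x - z) $ j) has_derivative (\<lambda>h. (h - 0) $ j)) (at x)"
        by (intro bounded_linear.has_derivative[OF bounded_linear_vec_nth] derivative_intros)
      from has_derivative_mult_right[OF this, of 2] show ?thesis by simp
    qed
    have "((\<lambda>x. (2 * (x - z) $ j) *\<^sub>R F1 (\<rho> x)) has_derivative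
        (\<lambda>h. (2 * (x - z) $ j) *\<^sub>R (2 * ((x - z) \<bullet> h)) *\<^sub>R F2 (\<rho> x) + (2 * h $ j) *\<^sub>R F1 (\<rho> x))) (at x)"
      by (rule has_derivative_scaleR[OF l r])
    then have "((\<lambda>x. partial j (\<lambda>x. Phi k x z) x) has_derivative
        (\<lambda>h. (2 * (x - z) $ j) *\<^sub>R (2 * ((x - z) \<bullet> h)) *\<^sub>R F2 (\<rho> x) + (2 * h $ j) *\<^sub>R F1 (\<rho> x))) (at x)"
      by (rule has_derivative_transform_within_open[of _ _ _ _ "- {z}"]) (use that d1 in auto)
    from partial_eq[OF this, of i]
    have "partial i (\<lambda>x. partial j (\<lambda>x. Phi k x z) x) x =
        ((2 * (x - z) $ j) * (2 * ((x - z) \<bullet> axis i 1))) *\<^sub>R F2 (\<rho> x) + (2 * (axis i 1 :: real^3) $ j) *\<^sub>R F1 (\<rho> x)"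
      by (simp only: scaleR_scaleR)
    also have "(2 * (x - z) $ j) * (2 * ((x - z) \<bullet> axis i 1)) = 4 * (x - z) $ i * (x - z) $ j"
      by (simp add: inner_axis algebra_simps)
    finally show ?thesis by (simp only: add.commute)
  qed
  \<comment> \<open>Opaque coefficients keep the continuity rules from treating these constants as quotients.\<close>
  define b c where bc: "b = 2 / k\<^sup>2" "c = 4 / k\<^sup>2"
  define N where "N x = (\<chi> i j. (if i = j then s 0 (\<rho> x) + b * s 1 (\<rho> x) else 0) +
       c * (x - z) $ i * (x - z) $ j * s 2 (\<rho> x))" for x
  have off: "(\<chi> i j. Im (green k x z $ i $ j)) = N x" if "x \<noteq> z" for x
  proof -
    have Im1: "Im (1 / of_real (k\<^sup>2) * w) = Im w / k\<^sup>2" for w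
      by (simp only: mult.commute[of "1 / _"] times_divide_eq_right mult_1_right Im_divide_of_real)
    show ?thesis
      unfolding N_def vec_eq_iff bc
      by (auto simp: green_eq_partial_partial_Phi d2[OF that] Im1 Phi[OF that] ImF[OF \<rho>[OF that]]
          ImF1[OF \<rho>[OF that]] ImF2[OF \<rho>[OF that]] axis_def add_divide_distrib simp del: of_real_power)
  qed
  have scont: "continuous_on UNIV (s n)" for n
    by (meson DERIV_isCont continuous_at_imp_continuous_on s(1))
  have Ncont: "continuous_on UNIV N"
  proof -
    have s\<rho>: "continuous_on UNIV (\<lambda>x. s n (\<rho> x))" for n
      unfolding \<rho>_def by (rule continuous_on_compose2[OF scont]) (auto intro!: continuous_intros)
    have "continuous_on UNIV (\<lambda>x. if i = j then s 0 (\<rho> x) + b * s 1 (\<rho> x) else 0)" for i j :: 3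
      by (cases "i = j") (simp_all add: continuous_intros s\<rho>)
    then show ?thesis
      unfolding N_def by (intro continuous_on_vec_lambda continuous_intros s\<rho>)
  qed
  have "Im_green k x z = N x" for x
  proof (cases "x = z")
    case True
    have "(N \<longlongrightarrow> N z) (at z)"
      using Ncont by (simp add: continuous_on_def)
    then have "((\<lambda>x. \<chi> i j. Im (green k x z $ i $ j)) \<longlongrightarrow> N z) (at z)"
      by (rule Lim_transform_eventually) (use off in \<open>auto simp: eventually_at_filter\<close>)
    then show ?thesis using True by (simp add: Im_green_def tendsto_Lim)
  qed (use off in \<open>simp add: Im_green_def Let_def\<close>)
  with s(1) show ?thesis by (intro that[of s]) (auto simp: N_def \<rho>_def bc)
qed

lemma Im_green_column_C1: "C_on 1 UNIV (\<lambda>x. Im_green k x z *v a)"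
proof -
  obtain s :: "nat \<Rightarrow> real \<Rightarrow> real" where s: "\<And>n t. (s n has_real_derivative s (Suc n) t) (at t)"
    and G: "\<And>x i j. Im_green k x z $ i $ j =
       (if i = j then s 0 ((x - z) \<bullet> (x - z)) + 2 / k\<^sup>2 * s 1 ((x - z) \<bullet> (x - z)) else 0) +
       4 / k\<^sup>2 * (x - z) $ i * (x - z) $ j * s 2 ((x - z) \<bullet> (x - z))"
    using Im_green_smooth_formula[of k z] by blast
  define \<rho> where "\<rho> x = (x - z) \<bullet> (x - z)" for x
  define b c where "b = 2 / k\<^sup>2" and "c = 4 / k\<^sup>2"
  have eq: "Im_green k x z *v a = s 0 (\<rho> x) *\<^sub>R a + (b * s 1 (\<rho> x)) *\<^sub>R a +
      (c * ((x - z) \<bullet> a) * s 2 (\<rho> x)) *\<^sub>R (x - z)" for x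
    unfolding vec_eq_iff
  proof
    fix i
    have ip: "(x - z) \<bullet> a = (\<Sum>j\<in>UNIV. (x - z) $ j * a $ j)" by (simp add: inner_vec_def)
    have "(Im_green k x z *v a) $ i =
        (\<Sum>j\<in>UNIV. (if i = j then (s 0 (\<rho> x) + b * s 1 (\<rho> x)) * a $ j else 0) +
          (c * (x - z) $ i * s 2 (\<rho> x)) * ((x - z) $ j * a $ j))"
      unfolding matrix_vector_mult_def G \<rho>_def[symmetric] b_def[symmetric] c_def[symmetric]
      by (simp del: vector_minus_component) (intro sum.cong refl; simp add: algebra_simps del: vector_minus_component)
    also have "\<dots> = (s 0 (\<rho> x) + b * s 1 (\<rho> x)) * a $ i +
        (c * (x - z) $ i * s 2 (\<rho> x)) * ((x - z) \<bullet> a)"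
      unfolding sum.distrib ip sum_distrib_left[symmetric] by simp
    also have "\<dots> = (s 0 (\<rho> x) *\<^sub>R a + (b * s 1 (\<rho> x)) *\<^sub>R a +
      (c * ((x - z) \<bullet> a) * s 2 (\<rho> x)) *\<^sub>R (x - z)) $ i"
      by (simp add: distrib_right del: vector_minus_component)
    finally show "(Im_green k x z *v a) $ i = \<dots>" .
  qed
  have sd: "((\<lambda>x. s n (\<rho> x)) has_derivative (\<lambda>h. 2 * ((x - z) \<bullet> h) * s (Suc n) (\<rho> x))) (at x)" for n x
    using has_derivative_radial[of "s n" "s (Suc n) (\<rho> x)" x z] s[of n "\<rho> x"]
    by (simp add: \<rho>_def has_real_derivative_iff_has_vector_derivative)
  note [derivative_intros] = sd
  define D where "D x h = (2 * ((x - z) \<bullet> h) * s 1 (\<rho> x)) *\<^sub>R a + (b * (2 * ((x - z) \<bullet> h) * s 2 (\<rho> x))) *\<^sub>R a +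
      ((c * ((x - z) \<bullet> a) * s 2 (\<rho> x)) *\<^sub>R h +
       (c * ((x - z) \<bullet> a) * (2 * ((x - z) \<bullet> h) * s 3 (\<rho> x)) + c * (h \<bullet> a) * s 2 (\<rho> x)) *\<^sub>R (x - z))" for x h
  have D: "((\<lambda>x. Im_green k x z *v a) has_derivative D x) (at x)" for x
    unfolding eq D_def
    by (auto intro!: derivative_eq_intros simp: fun_eq_iff numeral_2_eq_2 numeral_3_eq_3 algebra_simps)
  have scont: "continuous_on UNIV (s n)" for n
    by (meson DERIV_isCont continuous_at_imp_continuous_on s(1))
  have "continuous_on UNIV (\<lambda>x. D x (axis i 1))" for i
    unfolding D_def \<rho>_def by (intro continuous_intros continuous_on_compose2[OF scont]) auto
  moreover have "partial i (\<lambda>x. Im_green k x z *v a) = (\<lambda>x. D x (axis i 1))" for i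
    using partial_eq[OF D] by auto
  moreover have "(\<lambda>x. Im_green k x z *v a) differentiable_on UNIV"
    using D by (meson differentiable_at_imp_differentiable_on differentiable_def)
  ultimately show ?thesis by simp
qed

section \<open>Curls of continuously differentiable fields\<close>

lemma continuous_on_vector3:
  fixes f1 f2 f3 :: "'b::topological_space \<Rightarrow> 'a::{zero,topological_space}"
  assumes "continuous_on S f1" "continuous_on S f2" "continuous_on S f3"
  shows "continuous_on S (\<lambda>x. vector [f1 x, f2 x, f3 x] :: 'a^3)"
  unfolding continuous_on_def
proof
  fix x assume x: "x \<in> S"
  show "((\<lambda>x. vector [f1 x, f2 x, f3 x] :: 'a^3) \<longlongrightarrow> vector [f1 x, f2 x, f3 x]) (at x within S)"
  proof (rule vec_tendstoI)
    fix i :: 3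
    show "((\<lambda>x. (vector [f1 x, f2 x, f3 x] :: 'a^3) $ i) \<longlongrightarrow> (vector [f1 x, f2 x, f3 x] :: 'a^3) $ i) (at x within S)"
      using exhaust_3[of i] assms x by (auto simp: continuous_on_def)
  qed
qed

lemma C_on_1_iff: "C_on 1 S f \<longleftrightarrow> f differentiable_on S \<and> (\<forall>i. continuous_on S (partial i f))"
  by simp

lemma continuous_on_C1: "C_on 1 S f \<Longrightarrow> continuous_on S f"
  unfolding C_on_1_iff by (blast intro: differentiable_imp_continuous_on)

lemma continuous_on_curl:
  fixes F :: "real^3 \<Rightarrow> 'a::real_normed_field^3"
  assumes "open S" "C_on 1 S F"
  shows "continuous_on S (curl F)"
proof -
  have p: "partial i (\<lambda>y. F y $ j) x = partial i F x $ j" if "x \<in> S" for i j x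
  proof -
    have "F differentiable at x"
      using assms that unfolding C_on_1_iff differentiable_on_def by (metis at_within_open)
    then have "(F has_derivative frechet_derivative F (at x)) (at x)" by (simp add: frechet_derivative_works)
    from partial_eq[OF bounded_linear.has_derivative[OF bounded_linear_vec_nth this]]
    show ?thesis by (simp add: partial_def)
  qed
  have "continuous_on S (\<lambda>x. partial i (\<lambda>y. F y $ j) x)" for i j
  proof -
    have "continuous_on S (\<lambda>x. partial i F x $ j)"
      using assms(2) unfolding C_on_1_iff by (intro continuous_on_component) blast
    then show ?thesis by (rule continuous_on_eq) (simp add: p)
  qed
  then show ?thesis
    unfolding curl_def by (intro continuous_on_vector3 continuous_intros)
qed

section \<open>Measurability of the outward normal\<close>

text \<open>Two different unit normals \<open>n\<close>, \<open>n'\<close> would classify the points \<open>x + t (n - n')\<close>, \<open>t > 0\<close> small, in opposite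
  ways, since \<open>n - n'\<close> makes an acute angle with \<open>n\<close> and an obtuse one with \<open>n'\<close>.\<close>

lemma is_outward_normal_unique:
  assumes n: "is_outward_normal S x n" and n': "is_outward_normal S x n'"
  shows "n = n'"
proof (rule ccontr)
  assume ne: "n \<noteq> n'"
  define e where "e = n - n'"
  have ne1: "norm n = 1" "norm n' = 1" using n n' by (auto simp: is_outward_normal_def)
  have pos: "norm e > 0" using ne by (simp add: e_def)
  have nn: "n \<bullet> n = 1" "n' \<bullet> n' = 1" using ne1 by (simp_all add: dot_square_norm)
  have ee: "(norm e)\<^sup>2 = 2 - 2 * (n \<bullet> n')"
    unfolding power2_norm_eq_inner e_def using nn
    by (simp add: inner_diff_left inner_diff_right inner_commute)
  have en: "e \<bullet> n = (norm e)\<^sup>2 / 2" "e \<bullet> n' = - ((norm e)\<^sup>2 / 2)"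
    unfolding ee using nn by (simp_all add: e_def inner_diff_left inner_diff_right inner_commute field_simps)
  \<comment> \<open>The cosine of the angle between \<open>e\<close> and \<open>n\<close> is \<open>norm e / 2\<close>, so any smaller positive threshold works.\<close>
  define \<eta> where "\<eta> = norm e / 4"
  have "\<eta> > 0" using pos by (simp add: \<eta>_def)
  obtain r where r: "r > 0" "\<And>y. y \<in> ball x r \<Longrightarrow> (y - x) \<bullet> n > \<eta> * norm (y - x) \<Longrightarrow> y \<notin> S"
    using n \<open>\<eta> > 0\<close> unfolding is_outward_normal_def by meson
  obtain r' where r': "r' > 0" "\<And>y. y \<in> ball x r' \<Longrightarrow> (y - x) \<bullet> n' < - \<eta> * norm (y - x) \<Longrightarrow> y \<in> S"
    using n' \<open>\<eta> > 0\<close> unfolding is_outward_normal_def by meson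
  define t where "t = min r r' / (2 * norm e)"
  have t: "t > 0" using r(1) r'(1) pos by (simp add: t_def)
  define y where "y = x + t *\<^sub>R e"
  have "norm (y - x) = min r r' / 2"
    using t pos r(1) r'(1) by (simp add: y_def t_def)
  then have yb: "y \<in> ball x r" "y \<in> ball x r'"
    using r(1) r'(1) by (auto simp: dist_norm norm_minus_commute)
  have k: "t * (norm e)\<^sup>2 > 0" using t pos by simp
  have "(y - x) \<bullet> n > \<eta> * norm (y - x)" "(y - x) \<bullet> n' < - \<eta> * norm (y - x)"
    using t k pos by (auto simp: y_def en \<eta>_def power2_eq_square zero_less_mult_iff)
  then show False using r(2)[OF yb(1)] r'(2)[OF yb(2)] by blast
qed

text \<open>The cone condition in the definition of the outward normal at one threshold \<open>\<eta>\<close> and radius \<open>r\<close>, as a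
  set of pairs so that its topology can be used.\<close>

definition cone_separated :: "real \<Rightarrow> real \<Rightarrow> (real^3) set \<Rightarrow> ((real^3) \<times> (real^3)) set" where
  "cone_separated \<eta> r S = {(x, n). \<forall>y\<in>ball x r.
     ((y - x) \<bullet> n > \<eta> * norm (y - x) \<longrightarrow> y \<notin> S) \<and>
     ((y - x) \<bullet> n < - \<eta> * norm (y - x) \<longrightarrow> y \<in> S)}"

text \<open>For each test point \<open>y\<close>, violating the condition at \<open>y\<close> is an open condition on \<open>(x, n)\<close>.\<close>

lemma closed_cone_separated: "closed (cone_separated \<eta> r S)"
proof -
  have *: "cone_separated \<eta> r S =
     (\<Inter>y\<in>S. - {p. dist (fst p) y < r \<and> (y - fst p) \<bullet> snd p > \<eta> * norm (y - fst p)}) \<inter>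
     (\<Inter>y\<in>-S. - {p. dist (fst p) y < r \<and> (y - fst p) \<bullet> snd p < - \<eta> * norm (y - fst p)})"
    unfolding cone_separated_def by auto
  show ?thesis unfolding *
    by (intro closed_Int closed_INT ballI closed_Compl open_Collect_conj open_Collect_less continuous_intros)
qed

lemma cone_separated_mono:
  assumes "\<eta> \<le> \<eta>'" "r' \<le> r" "(x, n) \<in> cone_separated \<eta> r S"
  shows "(x, n) \<in> cone_separated \<eta>' r' S"
proof -
  have "(\<eta>' * norm (y - x) < (y - x) \<bullet> n \<longrightarrow> y \<notin> S) \<and> ((y - x) \<bullet> n < - \<eta>' * norm (y - x) \<longrightarrow> y \<in> S)"
    if y: "dist x y < r'" for y
  proof -
    have "\<eta> * norm (y - x) \<le> \<eta>' * norm (y - x)" using assms(1) by (simp add: mult_right_mono)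
    moreover have "\<eta> * norm (y - x) < (y - x) \<bullet> n \<longrightarrow> y \<notin> S" "(y - x) \<bullet> n < - \<eta> * norm (y - x) \<longrightarrow> y \<in> S"
      using assms(2,3) y by (auto simp: cone_separated_def)
    ultimately show ?thesis by auto
  qed
  then show ?thesis by (auto simp: cone_separated_def)
qed

lemma cone_separated_perturb:
  assumes "(x, n) \<in> cone_separated \<eta> r S" "norm (n - n') \<le> \<eta>'"
  shows "(x, n') \<in> cone_separated (\<eta> + \<eta>') r S"
proof -
  have "((\<eta> + \<eta>') * norm (y - x) < (y - x) \<bullet> n' \<longrightarrow> y \<notin> S) \<and> ((y - x) \<bullet> n' < - (\<eta> + \<eta>') * norm (y - x) \<longrightarrow> y \<in> S)"
    if y: "dist x y < r" for y
  proof -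
    have "\<bar>(y - x) \<bullet> (n - n')\<bar> \<le> norm (y - x) * norm (n - n')" by (rule Cauchy_Schwarz_ineq2)
    also have "\<dots> \<le> norm (y - x) * \<eta>'" using assms(2) by (simp add: mult_left_mono)
    finally have "\<bar>(y - x) \<bullet> n - (y - x) \<bullet> n'\<bar> \<le> \<eta>' * norm (y - x)"
      by (simp add: inner_diff_right mult.commute)
    moreover have "\<eta> * norm (y - x) < (y - x) \<bullet> n \<longrightarrow> y \<notin> S" "(y - x) \<bullet> n < - \<eta> * norm (y - x) \<longrightarrow> y \<in> S"
      using assms(1) y by (auto simp: cone_separated_def)
    ultimately show ?thesis by (auto simp: algebra_simps)
  qed
  then show ?thesis by (auto simp: cone_separated_def)
qed

lemma is_outward_normal_iff_cone_separated:
  "is_outward_normal S x n \<longleftrightarrow> x \<in> frontier S \<and> norm n = 1 \<and>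
     (\<forall>\<eta>>0. \<exists>r>0. (x, n) \<in> cone_separated \<eta> r S)"
  by (auto simp: is_outward_normal_def cone_separated_def)

text \<open>The quantifier over directions moves inside those over thresholds and radii: directions \<open>n\<^sub>i\<close> that
  work for threshold \<open>1/(i+1)\<close> accumulate in \<open>C\<close>, and their limit works for every threshold because
  replacing \<open>n\<^sub>i\<close> by a nearby direction only raises the threshold slightly.\<close>

lemma ex_normal_in_compact_iff:
  assumes "compact C" "C \<subseteq> sphere 0 1"
  shows "(\<exists>n\<in>C. is_outward_normal S x n) \<longleftrightarrow>
    x \<in> frontier S \<and> (\<forall>i. \<exists>j. \<exists>n. n \<in> C \<and> (x, n) \<in> cone_separated (inverse (Suc i)) (inverse (Suc j)) S)"
    (is "?L \<longleftrightarrow> ?R")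
proof
  assume ?L
  then obtain n where n: "n \<in> C" "is_outward_normal S x n" by blast
  have "\<exists>j. (x, n) \<in> cone_separated (inverse (Suc i)) (inverse (Suc j)) S" for i
  proof -
    obtain r where r: "r > 0" "(x, n) \<in> cone_separated (inverse (Suc i)) r S"
      using n unfolding is_outward_normal_iff_cone_separated by (metis inverse_positive_iff_positive of_nat_0_less_iff zero_less_Suc)
    obtain j where "inverse (real (Suc j)) < r" using reals_Archimedean r(1) by blast
    then show ?thesis using cone_separated_mono[OF order_refl _ r(2)] by (meson less_imp_le)
  qed
  moreover have "x \<in> frontier S" using n(2) by (simp add: is_outward_normal_def)
  ultimately show ?R using n(1) by blast
next
  assume R: ?R
  then obtain j n where n: "\<And>i. n i \<in> C"
    "\<And>i. (x, n i) \<in> cone_separated (inverse (Suc i)) (inverse (Suc (j i))) S" by metis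
  obtain l s where l: "l \<in> C" "strict_mono s" "(n \<circ> s) \<longlonglongrightarrow> l"
    using assms(1) n(1) unfolding compact_eq_seq_compact_metric seq_compact_def by metis
  have "\<exists>r>0. (x, l) \<in> cone_separated \<eta> r S" if \<eta>: "\<eta> > 0" for \<eta>
  proof -
    have "\<forall>\<^sub>F i in sequentially. dist ((n \<circ> s) i) l < \<eta> / 2"
      by (intro tendstoD[OF l(3)]) (use \<eta> in auto)
    moreover have "\<forall>\<^sub>F i in sequentially. inverse (real (Suc i)) < \<eta> / 2"
      using LIMSEQ_inverse_real_of_nat \<eta> by (intro order_tendstoD(2)) auto
    ultimately have "\<forall>\<^sub>F i in sequentially. dist ((n \<circ> s) i) l < \<eta> / 2 \<and> inverse (real (Suc i)) < \<eta> / 2"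
      by (rule eventually_conj)
    then obtain i where i: "dist (n (s i)) l < \<eta> / 2" "inverse (real (Suc i)) < \<eta> / 2"
      by (auto simp: eventually_sequentially)
    have "inverse (real (Suc (s i))) \<le> inverse (real (Suc i))"
      using seq_suble[OF l(2), of i] by (simp add: le_imp_inverse_le)
    then have "inverse (real (Suc (s i))) + \<eta> / 2 \<le> \<eta>" using i(2) by linarith
    moreover have "(x, l) \<in> cone_separated (inverse (Suc (s i)) + \<eta> / 2) (inverse (Suc (j (s i)))) S"
      using n(2)[of "s i"] i(1) by (intro cone_separated_perturb) (auto simp: dist_norm)
    ultimately have "(x, l) \<in> cone_separated \<eta> (inverse (Suc (j (s i)))) S"
      by (rule cone_separated_mono[OF _ order_refl])
    then show ?thesis by (intro exI[of _ "inverse (real (Suc (j (s i))))"]) auto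
  qed
  moreover have "x \<in> frontier S" using R by blast
  moreover have "norm l = 1" using l(1) assms(2) by auto
  ultimately have "is_outward_normal S x l" by (simp add: is_outward_normal_iff_cone_separated)
  then show ?L using l(1) by blast
qed

text \<open>Projection along a compact factor preserves closedness, so the characterisation above exhibits the
  set as a countable intersection of countable unions of closed sets.\<close>

lemma normals_in_compact_borel:
  assumes "compact C" "C \<subseteq> sphere 0 1"
  shows "{x. \<exists>n\<in>C. is_outward_normal S x n} \<in> sets borel"
proof -
  have c: "closed {x. \<exists>n. n \<in> C \<and> (x, n) \<in> cone_separated \<eta> r S}" for \<eta> r
  proof -
    have "closed {x. \<exists>n. n \<in> C \<and> (n, x) \<in> (\<lambda>(n, x). (x, n)) -` cone_separated \<eta> r S}"
    proof (rule closed_compact_projection[OF assms(1)])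
      show "closed ((\<lambda>(n, x). (x, n)) -` cone_separated \<eta> r S)"
        unfolding case_prod_beta
        by (intro continuous_closed_vimage closed_cone_separated continuous_intros)
    qed
    then show ?thesis by simp
  qed
  have "{x. \<exists>n\<in>C. is_outward_normal S x n} =
    frontier S \<inter> (\<Inter>i. \<Union>j. {x. \<exists>n. n \<in> C \<and> (x, n) \<in> cone_separated (inverse (Suc i)) (inverse (Suc j)) S})"
    by (rule set_eqI) (simp add: ex_normal_in_compact_iff[OF assms])
  also have "\<dots> \<in> sets borel"
    using c by (intro sets.Int sets.countable_INT sets.countable_UN) (auto simp: borel_closed)
  finally show ?thesis .
qed

lemma outward_normal_eq: "is_outward_normal S x n \<Longrightarrow> outward_normal S x = n"
  unfolding outward_normal_def using is_outward_normal_unique by (auto intro!: the_equality)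

lemma norm_outward_normal_le: "norm (outward_normal S x) \<le> 1"
proof (cases "\<exists>n. is_outward_normal S x n")
  case True
  then show ?thesis using outward_normal_eq by (fastforce simp: is_outward_normal_def)
qed (simp add: outward_normal_def)

lemma borel_measurable_outward_normal: "outward_normal S \<in> borel_measurable borel"
proof -
  have unit: "n \<in> sphere 0 1" if "is_outward_normal S x n" for x n
    using that by (auto simp: is_outward_normal_def)
  have cl: "outward_normal S -` T \<in> sets borel" if "closed T" for T
  proof -
    \<comment> \<open>Where the normal exists it is a unit vector; elsewhere it takes the default value 0.\<close>
    define A where "A = {x. \<exists>n\<in>T \<inter> sphere 0 1. is_outward_normal S x n}"
    define B where "B = {x. \<exists>n\<in>sphere 0 1. is_outward_normal S x n}"
    have A: "A \<in> sets borel" unfolding A_def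
      using that by (intro normals_in_compact_borel) (auto intro: closed_Int_compact)
    have B: "B \<in> sets borel" unfolding B_def by (intro normals_in_compact_borel) auto
    have eqB: "x \<in> B \<longleftrightarrow> (\<exists>n. is_outward_normal S x n)" for x
      unfolding B_def using unit by blast
    have eqA: "x \<in> A \<longleftrightarrow> x \<in> B \<and> outward_normal S x \<in> T" for x
      unfolding A_def B_def using outward_normal_eq[of S x] unit by blast
    have zero: "outward_normal S x = 0" if "x \<notin> B" for x
      using that unfolding eqB by (simp add: outward_normal_def)
    have "x \<in> outward_normal S -` T \<longleftrightarrow> x \<in> A \<union> (if 0 \<in> T then - B else {})" for x
      using eqA[of x] zero[of x] by (cases "x \<in> B") simp_all
    then have "outward_normal S -` T = A \<union> (if 0 \<in> T then - B else {})" by blast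
    then show ?thesis using A B by auto
  qed
  show ?thesis
  proof (rule borel_measurableI)
    fix T :: "(real^3) set" assume "open T"
    then have "outward_normal S -` (- T) \<in> sets borel" by (intro cl) auto
    then have "- (outward_normal S -` (- T)) \<in> sets borel" by (rule borel_comp)
    then show "outward_normal S -` T \<inter> space borel \<in> sets borel" by (simp add: vimage_Compl)
  qed
qed

section \<open>Area of Lipschitz boundaries\<close>

text \<open>Covers are finite and the bound \<open>K\<close> is uniform in the fineness \<open>r\<close>, which makes the notion
  evidently stable under finite unions while still bounding the Hausdorff measure.\<close>

definition finite_area :: "(real^3) set \<Rightarrow> bool" where
  "finite_area A \<longleftrightarrow> (\<exists>K. \<forall>r>0. \<exists>F. finite F \<and> A \<subseteq> \<Union>F \<and>
     (\<forall>U\<in>F. bounded U \<and> diameter U \<le> r) \<and> (\<Sum>U\<in>F. (diameter U)\<^sup>2) \<le> K)"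

lemma finite_area_empty: "finite_area {}"
proof -
  have "\<exists>F. finite F \<and> {} \<subseteq> \<Union>F \<and> (\<forall>U\<in>F. bounded U \<and> diameter U \<le> r) \<and>
      (\<Sum>U\<in>F. (diameter U)\<^sup>2) \<le> (0::real)" for r
    by (rule exI[of _ "{}"]) simp
  then show ?thesis unfolding finite_area_def by blast
qed

lemma finite_area_Un:
  assumes "finite_area A" "finite_area B"
  shows "finite_area (A \<union> B)"
proof -
  obtain K where K: "\<And>r. r > 0 \<Longrightarrow> \<exists>F. finite F \<and> A \<subseteq> \<Union>F \<and>
     (\<forall>U\<in>F. bounded U \<and> diameter U \<le> r) \<and> (\<Sum>U\<in>F. (diameter U)\<^sup>2) \<le> K"
    using assms(1) unfolding finite_area_def by metis
  obtain L where L: "\<And>r. r > 0 \<Longrightarrow> \<exists>F. finite F \<and> B \<subseteq> \<Union>F \<and>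
     (\<forall>U\<in>F. bounded U \<and> diameter U \<le> r) \<and> (\<Sum>U\<in>F. (diameter U)\<^sup>2) \<le> L"
    using assms(2) unfolding finite_area_def by metis
  show ?thesis unfolding finite_area_def
  proof (intro exI[of _ "K + L"] allI impI)
    fix r :: real assume "r > 0"
    obtain F where F: "finite F" "A \<subseteq> \<Union>F" "\<forall>U\<in>F. bounded U \<and> diameter U \<le> r"
      "(\<Sum>U\<in>F. (diameter U)\<^sup>2) \<le> K" using K[OF \<open>r > 0\<close>] by blast
    obtain G where G: "finite G" "B \<subseteq> \<Union>G" "\<forall>U\<in>G. bounded U \<and> diameter U \<le> r"
      "(\<Sum>U\<in>G. (diameter U)\<^sup>2) \<le> L" using L[OF \<open>r > 0\<close>] by blast
    have "(\<Sum>U\<in>F\<union>G. (diameter U)\<^sup>2) \<le> (\<Sum>U\<in>F. (diameter U)\<^sup>2) + (\<Sum>U\<in>G. (diameter U)\<^sup>2)"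
      using sum.union_inter[OF F(1) G(1), of "\<lambda>U. (diameter U)\<^sup>2"]
        sum_nonneg[of "F \<inter> G" "\<lambda>U. (diameter U)\<^sup>2"] by simp
    then have "(\<Sum>U\<in>F\<union>G. (diameter U)\<^sup>2) \<le> K + L" using F(4) G(4) by linarith
    then show "\<exists>F. finite F \<and> A \<union> B \<subseteq> \<Union>F \<and>
       (\<forall>U\<in>F. bounded U \<and> diameter U \<le> r) \<and> (\<Sum>U\<in>F. (diameter U)\<^sup>2) \<le> K + L"
      using F(1-3) G(1-3) by (intro exI[of _ "F \<union> G"]) auto
  qed
qed

lemma finite_area_Union: "finite \<A> \<Longrightarrow> (\<And>A. A \<in> \<A> \<Longrightarrow> finite_area A) \<Longrightarrow> finite_area (\<Union>\<A>)"
  by (induction rule: finite_induct) (auto simp: finite_area_empty intro: finite_area_Un)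

lemma finite_area_subset: "finite_area B \<Longrightarrow> A \<subseteq> B \<Longrightarrow> finite_area A"
  unfolding finite_area_def by (meson subset_trans)

lemma hausdorff2_outer_finite:
  assumes "finite_area A"
  shows "hausdorff2_outer A < \<infinity>"
proof -
  obtain K where K: "\<And>r. r > 0 \<Longrightarrow> \<exists>F. finite F \<and> A \<subseteq> \<Union>F \<and>
     (\<forall>U\<in>F. bounded U \<and> diameter U \<le> r) \<and> (\<Sum>U\<in>F. (diameter U)\<^sup>2) \<le> K"
    using assms(1) unfolding finite_area_def by metis
  have "hausdorff2_pre r A \<le> ennreal (pi / 4 * K)" if "r > 0" for r
  proof -
    obtain F where F: "finite F" "A \<subseteq> \<Union>F" "\<forall>U\<in>F. bounded U \<and> diameter U \<le> r"
      "(\<Sum>U\<in>F. (diameter U)\<^sup>2) \<le> K" using K[OF \<open>r > 0\<close>] by blast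
    obtain f where f: "bij_betw f {..<card F} F"
      using F(1) ex_bij_betw_nat_finite[OF F(1)] by (auto simp: atLeast0LessThan)
    define U where "U i = (if i < card F then f i else {})" for i
    have fF: "f i \<in> F" if "i < card F" for i using f that bij_betwE by blast
    have sub: "A \<subseteq> (\<Union>i. U i)"
    proof
      fix a assume "a \<in> A"
      then obtain V where V: "V \<in> F" "a \<in> V" using F(2) by blast
      then have "V \<in> f ` {..<card F}" using f by (simp add: bij_betw_def)
      then obtain i where "i < card F" "f i = V" by auto
      then show "a \<in> (\<Union>i. U i)" using V by (auto simp: U_def)
    qed
    have Ub: "\<forall>i. bounded (U i) \<and> diameter (U i) \<le> r" using F(3) fF \<open>r > 0\<close> by (auto simp: U_def)
    have "(\<Sum>i. ennreal (pi / 4 * (diameter (U i))\<^sup>2)) = (\<Sum>i<card F. ennreal (pi / 4 * (diameter (U i))\<^sup>2))"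
      by (rule suminf_finite) (auto simp: U_def)
    also have "\<dots> = ennreal (\<Sum>i<card F. pi / 4 * (diameter (f i))\<^sup>2)"
      by (subst sum_ennreal) (auto simp: U_def)
    also have "(\<Sum>i<card F. pi / 4 * (diameter (f i))\<^sup>2) = (\<Sum>V\<in>F. pi / 4 * (diameter V)\<^sup>2)"
      by (rule sum.reindex_bij_betw[OF f])
    also have "(\<Sum>V\<in>F. pi / 4 * (diameter V)\<^sup>2) = pi / 4 * (\<Sum>V\<in>F. (diameter V)\<^sup>2)"
      by (rule sum_distrib_left[symmetric])
    also have "ennreal \<dots> \<le> ennreal (pi / 4 * K)"
      by (intro ennreal_leI mult_left_mono F(4)) simp
    finally have le: "(\<Sum>i. ennreal (pi / 4 * (diameter (U i))\<^sup>2)) \<le> ennreal (pi / 4 * K)" .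
    show ?thesis unfolding hausdorff2_pre_def
      by (rule INF_lower2[of U]) (use sub Ub le in auto)
  qed
  then have "hausdorff2_outer A \<le> ennreal (pi / 4 * K)"
    unfolding hausdorff2_outer_def by (intro SUP_least) auto
  also have "\<dots> < \<infinity>" by simp
  finally show ?thesis .
qed

text \<open>If two bounded real functions together control distances in \<open>A\<close>, then \<open>A\<close> is no larger than
  a planar square: pulling back a grid of mesh \<open>1/n\<close> gives \<open>O(n\<^sup>2)\<close> cells of diameter \<open>O(1/n)\<close>.\<close>

lemma finite_area_two_coordinates:
  fixes \<alpha> \<beta> :: "real^3 \<Rightarrow> real"
  assumes bd: "\<And>y. y \<in> A \<Longrightarrow> \<bar>\<alpha> y\<bar> \<le> R" "\<And>y. y \<in> A \<Longrightarrow> \<bar>\<beta> y\<bar> \<le> R"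
    and lip: "\<And>y y'. y \<in> A \<Longrightarrow> y' \<in> A \<Longrightarrow> norm (y - y') \<le> C * (\<bar>\<alpha> y - \<alpha> y'\<bar> + \<bar>\<beta> y - \<beta> y'\<bar>)"
    and "C \<ge> 0" "R \<ge> 0"
  shows "finite_area A"
  unfolding finite_area_def
proof (intro exI[of _ "(2 * R + 3)\<^sup>2 * (2 * C)\<^sup>2"] allI impI)
  fix r :: real assume r: "r > 0"
  obtain m :: nat where m: "2 * C / r < real m" using reals_Archimedean2 by blast
  define n where "n = real (Suc m)"
  have n: "n \<ge> 1" "2 * C / n \<le> r"
  proof -
    show "n \<ge> 1" by (simp add: n_def)
    have "2 * C < real m * r" using m r by (simp add: field_simps)
    also have "\<dots> \<le> n * r" using r by (simp add: n_def)
    finally show "2 * C / n \<le> r" using \<open>n \<ge> 1\<close> by (simp add: field_simps)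
  qed
  define V where "V p = {y \<in> A. \<lfloor>n * \<alpha> y\<rfloor> = fst p \<and> \<lfloor>n * \<beta> y\<rfloor> = snd p}" for p
  define I where "I = {\<lfloor>- (n * R)\<rfloor>..\<lfloor>n * R\<rfloor>}"
  have I: "\<lfloor>n * t\<rfloor> \<in> I" if "\<bar>t\<bar> \<le> R" for t
  proof -
    have "\<bar>n * t\<bar> \<le> n * R" using that n(1) by (simp add: abs_mult)
    then show ?thesis unfolding I_def by (auto intro!: floor_mono)
  qed
  have cardI: "real (card I) \<le> n * (2 * R + 3)"
  proof -
    have "real (card I) \<le> 2 * (n * R) + 2"
    proof -
      have "0 \<le> n * R" using n(1) \<open>R \<ge> 0\<close> by simp
      then have "\<lfloor>- (n * R)\<rfloor> \<le> \<lfloor>n * R\<rfloor>" by (intro floor_mono) simp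
      then have "real (card I) = real_of_int (\<lfloor>n * R\<rfloor> - \<lfloor>- (n * R)\<rfloor> + 1)"
        by (simp add: I_def)
      then show ?thesis by linarith
    qed
    also have "\<dots> \<le> 2 * (n * R) + 3 * n" using n(1) by simp
    finally show ?thesis by (simp add: algebra_simps)
  qed
  have close: "\<bar>s - t\<bar> \<le> 1 / n" if "\<lfloor>n * s\<rfloor> = \<lfloor>n * t\<rfloor>" for s t
  proof -
    have "\<bar>n * s - n * t\<bar> \<le> 1" using that by linarith
    then have "n * \<bar>s - t\<bar> \<le> 1" using n(1) by (simp add: abs_mult flip: right_diff_distrib)
    then show ?thesis using n(1) by (simp add: field_simps)
  qed
  have dV: "norm (y - y') \<le> 2 * C / n" if "y \<in> V p" "y' \<in> V p" for p y y'
  proof -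
    have "\<bar>\<alpha> y - \<alpha> y'\<bar> \<le> 1 / n" "\<bar>\<beta> y - \<beta> y'\<bar> \<le> 1 / n"
      using that by (auto simp: V_def intro!: close)
    then have "\<bar>\<alpha> y - \<alpha> y'\<bar> + \<bar>\<beta> y - \<beta> y'\<bar> \<le> 2 / n" by simp
    then have "C * (\<bar>\<alpha> y - \<alpha> y'\<bar> + \<bar>\<beta> y - \<beta> y'\<bar>) \<le> C * (2 / n)" using \<open>C \<ge> 0\<close> by (rule mult_left_mono)
    moreover have "norm (y - y') \<le> C * (\<bar>\<alpha> y - \<alpha> y'\<bar> + \<bar>\<beta> y - \<beta> y'\<bar>)"
      using that by (intro lip) (auto simp: V_def)
    ultimately show ?thesis by (simp add: mult.commute)
  qed
  have diamV: "diameter (V p) \<le> 2 * C / n" for p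
    using dV n(1) \<open>C \<ge> 0\<close> by (intro diameter_le) auto
  have bV: "bounded (V p)" for p
    unfolding bounded_any_center[where a="SOME y. y \<in> V p"]
  proof (intro exI ballI)
    fix y assume "y \<in> V p"
    then have "(SOME y. y \<in> V p) \<in> V p" by (metis someI)
    then show "dist (SOME y. y \<in> V p) y \<le> 2 * C / n" using dV \<open>y \<in> V p\<close> by (simp add: dist_norm)
  qed
  have "(\<Sum>U\<in>V ` (I \<times> I). (diameter U)\<^sup>2) \<le> (\<Sum>U\<in>V ` (I \<times> I). (2 * C / n)\<^sup>2)"
    by (intro sum_mono) (auto intro!: power_mono diamV diameter_ge_0 bV)
  also have "\<dots> = real (card (V ` (I \<times> I))) * (2 * C / n)\<^sup>2" by simp
  also have "\<dots> \<le> (real (card I))\<^sup>2 * (2 * C / n)\<^sup>2"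
  proof -
    have "card (V ` (I \<times> I)) \<le> card I * card I"
      using card_image_le[of "I \<times> I" V] by (simp add: I_def card_cartesian_product)
    then have "real (card (V ` (I \<times> I))) \<le> (real (card I))\<^sup>2"
      unfolding power2_eq_square by (metis of_nat_le_iff of_nat_mult)
    then show ?thesis by (rule mult_right_mono) simp
  qed
  also have "\<dots> \<le> (n * (2 * R + 3))\<^sup>2 * (2 * C / n)\<^sup>2"
    by (intro mult_right_mono power_mono cardI) auto
  also have "\<dots> = (2 * R + 3)\<^sup>2 * (2 * C)\<^sup>2"
    using n(1) by (simp add: power_mult_distrib power_divide)
  finally have "(\<Sum>U\<in>V ` (I \<times> I). (diameter U)\<^sup>2) \<le> (2 * R + 3)\<^sup>2 * (2 * C)\<^sup>2" .
  moreover have "A \<subseteq> \<Union>(V ` (I \<times> I))"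
  proof
    fix y assume "y \<in> A"
    then have "y \<in> V (\<lfloor>n * \<alpha> y\<rfloor>, \<lfloor>n * \<beta> y\<rfloor>)" "(\<lfloor>n * \<alpha> y\<rfloor>, \<lfloor>n * \<beta> y\<rfloor>) \<in> I \<times> I"
      using bd by (auto simp: V_def intro: I)
    then show "y \<in> \<Union>(V ` (I \<times> I))" by blast
  qed
  moreover have "finite (V ` (I \<times> I))" by (simp add: I_def)
  moreover have "\<forall>U\<in>V ` (I \<times> I). bounded U \<and> diameter U \<le> r"
    using bV order_trans[OF diamV n(2)] by blast
  ultimately show "\<exists>F. finite F \<and> A \<subseteq> \<Union>F \<and> (\<forall>U\<in>F. bounded U \<and> diameter U \<le> r) \<and>
      (\<Sum>U\<in>F. (diameter U)\<^sup>2) \<le> (2 * R + 3)\<^sup>2 * (2 * C)\<^sup>2" by blast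
qed

lemma norm_le_sum_components: "norm (v :: real^3) \<le> \<bar>v$1\<bar> + \<bar>v$2\<bar> + \<bar>v$3\<bar>"
  using norm_le_l1_cart[of v] by (simp add: sum_3)

text \<open>After a rotation taking \<open>e\<close> to the third axis, the first two coordinates control the distance of
  points on the graph, since the third one depends on them in a Lipschitz way.\<close>

lemma finite_area_lipschitz_graph:
  fixes e :: "real^3" and g :: "real^3 \<Rightarrow> real"
  assumes e: "norm e = 1" and g: "L-lipschitz_on UNIV g" and "bounded A"
    and graph: "\<And>y. y \<in> A \<Longrightarrow> y \<bullet> e = g (y - (y \<bullet> e) *\<^sub>R e)"
  shows "finite_area A"
proof -
  obtain f :: "real^3 \<Rightarrow> real^3" where f: "orthogonal_transformation f" "f e = axis 3 1"
    using orthogonal_transformation_exists_1[of e "axis 3 1"] e by (metis norm_axis_1)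
  have lin: "linear f" using f(1) by (rule orthogonal_transformation_linear)
  have f3: "f y $ 3 = y \<bullet> e" for y
  proof -
    have "f y $ 3 = f y \<bullet> axis 3 1" by (simp add: inner_axis)
    also have "\<dots> = y \<bullet> e" using f by (metis orthogonal_transformation_def)
    finally show ?thesis .
  qed
  have nf: "norm (f y) = norm y" for y using f(1) by (rule orthogonal_transformation_norm)
  have L: "L \<ge> 0" using g by (rule lipschitz_on_nonneg)
  obtain R where R: "\<And>y. y \<in> A \<Longrightarrow> norm y \<le> R" "R > 0"
    using \<open>bounded A\<close> by (meson bounded_pos)
  show ?thesis
  proof (rule finite_area_two_coordinates[where \<alpha> = "\<lambda>y. f y $ 1" and \<beta> = "\<lambda>y. f y $ 2" and R = R and C = "1 + L"])
    show "\<bar>f y $ 1\<bar> \<le> R" "\<bar>f y $ 2\<bar> \<le> R" if "y \<in> A" for y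
      using R(1)[OF that] component_le_norm_cart[of "f y"] nf[of y] by (metis order_trans)+
    fix y y' assume A: "y \<in> A" "y' \<in> A"
    define P where "P z = z - (z \<bullet> e) *\<^sub>R e" for z
    define v where "v = y - y'"
    have fv: "f v $ i = f y $ i - f y' $ i" for i by (simp add: v_def linear_diff[OF lin])
    \<comment> \<open>\<open>P\<close> is the orthogonal projection along \<open>e\<close>, so rotating \<open>P v\<close> deletes the third coordinate.\<close>
    have fP: "f (P v) = f v - (v \<bullet> e) *\<^sub>R axis 3 1"
      by (simp add: P_def linear_diff[OF lin] linear_scale[OF lin] f(2))
    have "norm (P v) = norm (f (P v))" by (simp add: nf)
    also have "\<dots> \<le> \<bar>f v $ 1\<bar> + \<bar>f v $ 2\<bar>"
      using norm_le_sum_components[of "f (P v)"] by (simp add: fP f3 axis_def)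
    finally have Pv: "norm (P v) \<le> \<bar>f v $ 1\<bar> + \<bar>f v $ 2\<bar>" .
    have "\<bar>f v $ 3\<bar> = \<bar>g (P y) - g (P y')\<bar>"
      using graph[OF A(1)] graph[OF A(2)] by (simp add: f3 v_def P_def inner_diff_left)
    also have "\<dots> \<le> L * norm (P y - P y')"
      using lipschitz_onD[OF g, of "P y" "P y'"] by (simp add: dist_norm)
    also have "P y - P y' = P v" by (simp add: P_def v_def algebra_simps inner_diff_left)
    also have "L * norm (P v) \<le> L * (\<bar>f v $ 1\<bar> + \<bar>f v $ 2\<bar>)" using Pv L by (rule mult_left_mono)
    finally have "norm v \<le> (1 + L) * (\<bar>f v $ 1\<bar> + \<bar>f v $ 2\<bar>)"
      using norm_le_sum_components[of "f v"] by (simp add: nf distrib_right)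
    then show "norm (y - y') \<le> (1 + L) * (\<bar>f y $ 1 - f y' $ 1\<bar> + \<bar>f y $ 2 - f y' $ 2\<bar>)"
      by (simp add: fv) (simp add: v_def)
  qed (use L R(2) in auto)
qed

text \<open>A frontier point is not in the open set \<open>\<Omega>\<close>, so it does not lie below the graph; strictly above the
  graph it would have a neighbourhood that misses \<open>\<Omega>\<close>.\<close>

lemma frontier_of_subgraph:
  fixes \<Omega> :: "(real^3) set" and g :: "real^3 \<Rightarrow> real"
  assumes "open \<Omega>" and g: "continuous_on UNIV g"
    and sub: "\<Omega> \<inter> ball x r = {y \<in> ball x r. y \<bullet> e < g (y - (y \<bullet> e) *\<^sub>R e)}"
    and y: "y \<in> frontier \<Omega>" "y \<in> ball x r"
  shows "y \<bullet> e = g (y - (y \<bullet> e) *\<^sub>R e)"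
proof (rule ccontr)
  assume ne: "y \<bullet> e \<noteq> g (y - (y \<bullet> e) *\<^sub>R e)"
  have yn: "y \<notin> \<Omega>" "y \<in> closure \<Omega>"
    using y(1) \<open>open \<Omega>\<close> by (auto simp: frontier_def interior_open)
  have below: "w \<in> \<Omega> \<longleftrightarrow> w \<bullet> e < g (w - (w \<bullet> e) *\<^sub>R e)" if "w \<in> ball x r" for w
  proof -
    have "w \<in> \<Omega> \<inter> ball x r \<longleftrightarrow> w \<in> ball x r \<and> w \<bullet> e < g (w - (w \<bullet> e) *\<^sub>R e)" by (simp only: sub mem_Collect_eq)
    then show ?thesis using that by simp
  qed
  have gt: "y \<bullet> e > g (y - (y \<bullet> e) *\<^sub>R e)" using below[OF y(2)] yn(1) ne by linarith
  define W where "W = ball x r \<inter> {z. g (z - (z \<bullet> e) *\<^sub>R e) < z \<bullet> e}"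
  have "open W" unfolding W_def
    by (intro open_Int open_ball open_Collect_less continuous_intros
          continuous_on_compose2[OF g]) auto
  moreover have "W \<inter> \<Omega> = {}"
  proof -
    have "w \<notin> \<Omega>" if "w \<in> W" for w using that below[of w] by (simp add: W_def)
    then show ?thesis by blast
  qed
  ultimately have "W \<inter> closure \<Omega> = {}" by (simp add: open_Int_closure_eq_empty)
  moreover have "y \<in> W" using gt y(2) by (simp add: W_def)
  ultimately show False using yn(2) by blast
qed

lemma finite_area_frontier:
  assumes "regular_domain \<Omega>"
  shows "finite_area (frontier \<Omega>)"
proof -
  have bd: "open \<Omega>" "bounded \<Omega>"
    using assms by (auto simp: regular_domain_def bounded_domain_def)
  have "\<exists>r>0. finite_area (frontier \<Omega> \<inter> ball x r)" if "x \<in> frontier \<Omega>" for x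
  proof -
    have "\<exists>e r L. \<exists>g :: real^3 \<Rightarrow> real. norm e = 1 \<and> r > 0 \<and> L-lipschitz_on UNIV g \<and>
        \<Omega> \<inter> ball x r = {y \<in> ball x r. y \<bullet> e < g (y - (y \<bullet> e) *\<^sub>R e)}"
      using assms that by (simp add: regular_domain_def)
    then obtain e r L and g :: "real^3 \<Rightarrow> real" where
      *: "norm e = 1" "r > 0" "L-lipschitz_on UNIV g"
        "\<Omega> \<inter> ball x r = {y \<in> ball x r. y \<bullet> e < g (y - (y \<bullet> e) *\<^sub>R e)}"
      by blast
    have "finite_area (frontier \<Omega> \<inter> ball x r)"
    proof (rule finite_area_lipschitz_graph[OF *(1,3)])
      show "bounded (frontier \<Omega> \<inter> ball x r)" by (simp add: bounded_Int)
      show "y \<bullet> e = g (y - (y \<bullet> e) *\<^sub>R e)" if "y \<in> frontier \<Omega> \<inter> ball x r" for y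
        using that frontier_of_subgraph[OF bd(1) lipschitz_on_continuous_on[OF *(3)] *(4)] by auto
    qed
    with *(2) show ?thesis by blast
  qed
  then obtain r where r: "\<And>x. x \<in> frontier \<Omega> \<Longrightarrow> r x > 0 \<and> finite_area (frontier \<Omega> \<inter> ball x (r x))"
    by metis
  have comp: "compact (frontier \<Omega>)" using bd(2) by (rule compact_frontier_bounded)
  have cover: "frontier \<Omega> \<subseteq> (\<Union>x\<in>frontier \<Omega>. ball x (r x))" using r by force
  obtain X where X: "X \<subseteq> frontier \<Omega>" "finite X" "frontier \<Omega> \<subseteq> (\<Union>x\<in>X. ball x (r x))"
    by (rule compactE_image[OF comp _ cover]) auto
  have "finite_area (\<Union>((\<lambda>x. frontier \<Omega> \<inter> ball x (r x)) ` X))"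
    using X r by (intro finite_area_Union) auto
  then show ?thesis by (rule finite_area_subset) (use X(3) in blast)
qed

lemma sets_hausdorff2: "sets hausdorff2 = sets borel"
  using sets.sigma_sets_eq[of "borel :: (real^3) measure"]
  by (simp add: hausdorff2_def sets_measure_of_conv)

lemma space_hausdorff2: "space hausdorff2 = UNIV"
  by (simp add: hausdorff2_def space_measure_of_conv)

text \<open>A measure built by \<open>measure_of\<close> has either the prescribed value or the default value 0.\<close>

lemma emeasure_hausdorff2_le: "emeasure hausdorff2 A \<le> hausdorff2_outer A"
  by (simp add: hausdorff2_def emeasure_measure_of_conv)

lemma space_surface_measure: "space (surface_measure S) = frontier S"
  by (simp add: surface_measure_def space_restrict_space space_hausdorff2)

lemma sets_surface_measure: "sets (surface_measure S) = sets (restrict_space borel (frontier S))"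
  by (simp add: surface_measure_def sets_restrict_space sets_hausdorff2)

lemma measurable_surface_measure:
  "borel_measurable (surface_measure S) = borel_measurable (restrict_space borel (frontier S))"
  by (rule measurable_cong_sets[OF sets_surface_measure refl])

lemma finite_measure_surface_measure:
  assumes "regular_domain \<Omega>"
  shows "finite_measure (surface_measure \<Omega>)"
proof
  have "emeasure (surface_measure \<Omega>) (space (surface_measure \<Omega>)) = emeasure hausdorff2 (frontier \<Omega>)"
    unfolding space_surface_measure unfolding surface_measure_def
    by (rule emeasure_restrict_space) (auto simp: sets_hausdorff2 space_hausdorff2)
  also have "\<dots> \<le> hausdorff2_outer (frontier \<Omega>)" by (rule emeasure_hausdorff2_le)
  also have "\<dots> < \<infinity>" by (intro hausdorff2_outer_finite finite_area_frontier assms)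
  finally show "emeasure (surface_measure \<Omega>) (space (surface_measure \<Omega>)) \<noteq> \<infinity>" by simp
qed

section \<open>Bounded measurable fields on the boundary\<close>

text \<open>The class of fields to which both the kernels and the exact data belong. It is closed under pointwise
  continuous operations, which is how cross products with the normal are handled.\<close>

definition bounded_borel :: "'a measure \<Rightarrow> ('a \<Rightarrow> 'b::real_normed_vector) \<Rightarrow> bool" where
  "bounded_borel M f \<longleftrightarrow> f \<in> borel_measurable M \<and> bounded (f ` space M)"

text \<open>Bounded functions take values in compact sets, and \<open>\<phi>\<close> is bounded on the product of two compact
  sets.\<close>

lemma bounded_borel_compose2:
  fixes f :: "'a \<Rightarrow> 'b::euclidean_space" and g :: "'a \<Rightarrow> 'c::euclidean_space"
    and \<phi> :: "'b \<Rightarrow> 'c \<Rightarrow> 'd::real_normed_vector"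
  assumes f: "bounded_borel M f" and g: "bounded_borel M g"
    and \<phi>: "continuous_on UNIV (\<lambda>p. \<phi> (fst p) (snd p))"
  shows "bounded_borel M (\<lambda>x. \<phi> (f x) (g x))"
proof -
  have "(\<lambda>x. \<phi> (f x) (g x)) \<in> borel_measurable M"
    using f g by (intro borel_measurable_continuous_Pair[OF _ _ \<phi>]) (simp_all add: bounded_borel_def)
  moreover have "bounded ((\<lambda>x. \<phi> (f x) (g x)) ` space M)"
  proof -
    let ?K = "closure (f ` space M) \<times> closure (g ` space M)"
    have "compact ?K" using f g by (intro compact_Times) (simp_all add: bounded_borel_def)
    then have "bounded ((\<lambda>p. \<phi> (fst p) (snd p)) ` ?K)"
      by (intro compact_imp_bounded compact_continuous_image continuous_on_subset[OF \<phi>]) auto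
    moreover have "(\<lambda>x. \<phi> (f x) (g x)) ` space M \<subseteq> (\<lambda>p. \<phi> (fst p) (snd p)) ` ?K"
    proof
      fix y assume "y \<in> (\<lambda>x. \<phi> (f x) (g x)) ` space M"
      then obtain x where x: "x \<in> space M" "y = \<phi> (f x) (g x)" by blast
      then have "(f x, g x) \<in> ?K"
        using closure_subset[of "f ` space M"] closure_subset[of "g ` space M"] by blast
      then show "y \<in> (\<lambda>p. \<phi> (fst p) (snd p)) ` ?K" using x(2) by (intro image_eqI[of _ _ "(f x, g x)"]) simp_all
    qed
    ultimately show ?thesis by (rule bounded_subset)
  qed
  ultimately show ?thesis by (simp add: bounded_borel_def)
qed

lemma bounded_borel_compose:
  fixes f :: "'a \<Rightarrow> 'b::euclidean_space"
  assumes "bounded_borel M f" "continuous_on UNIV \<phi>"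
  shows "bounded_borel M (\<lambda>x. \<phi> (f x))"
  by (rule bounded_borel_compose2[OF assms(1,1), of "\<lambda>a b. \<phi> a"])
    (auto intro!: continuous_intros continuous_on_compose2[OF assms(2)])

lemma bounded_borel_surface_continuous:
  assumes "bounded \<Omega>" "continuous_on (frontier \<Omega>) f"
  shows "bounded_borel (surface_measure \<Omega>) f"
proof -
  have "compact (f ` frontier \<Omega>)"
    by (intro compact_continuous_image assms compact_frontier_bounded)
  then show ?thesis
    unfolding bounded_borel_def space_surface_measure measurable_surface_measure
    by (auto intro: borel_measurable_continuous_on_restrict assms compact_imp_bounded)
qed

lemma bounded_borel_outward_normal: "bounded_borel (surface_measure \<Omega>) (outward_normal \<Omega>)"
  unfolding bounded_borel_def measurable_surface_measure
  by (auto intro!: measurable_restrict_space1 borel_measurable_outward_normal boundedI norm_outward_normal_le)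

lemma continuous_on_cvec: "continuous_on UNIV cvec"
  unfolding cvec_def by (intro continuous_on_vec_lambda continuous_intros)

lemma continuous_on_cross3: "continuous_on UNIV (\<lambda>p. cross3 (fst p) (snd p))"
  by (intro continuous_on_cross continuous_intros)

lemma continuous_on_ccross: "continuous_on UNIV (\<lambda>p. ccross (fst p) (snd p))"
  unfolding ccross_def by (intro continuous_on_vector3 continuous_intros)

lemma bounded_borel_curl_trace:
  assumes "bounded \<Omega>" "continuous_on (frontier \<Omega>) (curl u)"
  shows "bounded_borel (surface_measure \<Omega>) (curl_trace \<Omega> u)"
  unfolding curl_trace_def[abs_def]
  by (intro bounded_borel_compose2[where \<phi> = ccross] bounded_borel_compose[where \<phi> = cvec]
      bounded_borel_outward_normal bounded_borel_surface_continuous assms continuous_on_cvec continuous_on_ccross)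

section \<open>Square-integrable fields on a finite measure space\<close>

lemma in_L2_bounded_borel:
  assumes "finite_measure M" "bounded_borel M f"
  shows "in_L2 M f"
proof -
  interpret finite_measure M by fact
  obtain B where B: "\<And>x. x \<in> space M \<Longrightarrow> norm (f x) \<le> B"
    using assms(2) by (auto simp: bounded_borel_def bounded_iff)
  have [measurable]: "f \<in> borel_measurable M" using assms(2) by (simp add: bounded_borel_def)
  have "AE x in M. norm ((norm (f x))\<^sup>2) \<le> B\<^sup>2"
    using B by (intro AE_I2) (simp add: power_mono)
  then have "integrable M (\<lambda>x. (norm (f x))\<^sup>2)"
    by (intro integrable_const_bound[of _ "B\<^sup>2"]) auto
  then show ?thesis by (simp add: in_L2_def)
qed

lemma in_L2_diff:
  assumes "in_L2 M f" "in_L2 M g"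
  shows "in_L2 M (\<lambda>x. f x - g x)"
proof -
  have [measurable]: "f \<in> borel_measurable M" "g \<in> borel_measurable M"
    using assms by (auto simp: in_L2_def)
  have "integrable M (\<lambda>x. 2 * (norm (f x))\<^sup>2 + 2 * (norm (g x))\<^sup>2)"
    using assms by (auto simp: in_L2_def)
  then have "integrable M (\<lambda>x. (norm (f x - g x))\<^sup>2)"
  proof (rule Bochner_Integration.integrable_bound)
    show "AE x in M. norm ((norm (f x - g x))\<^sup>2) \<le> norm (2 * (norm (f x))\<^sup>2 + 2 * (norm (g x))\<^sup>2)"
    proof (intro AE_I2)
      fix x
      have "(norm (f x - g x))\<^sup>2 \<le> (norm (f x) + norm (g x))\<^sup>2"
        by (intro power_mono norm_triangle_ineq4) simp
      also have "\<dots> \<le> 2 * (norm (f x))\<^sup>2 + 2 * (norm (g x))\<^sup>2"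
        using zero_le_power2[of "norm (f x) - norm (g x)"] by (simp add: power2_sum power2_diff)
      finally show "norm ((norm (f x - g x))\<^sup>2) \<le> norm (2 * (norm (f x))\<^sup>2 + 2 * (norm (g x))\<^sup>2)" by simp
    qed
  qed simp
  then show ?thesis by (simp add: in_L2_def)
qed

text \<open>The Cauchy-Schwarz inequality against the constant function 1.\<close>

lemma integral_norm_le_L2_norm:
  assumes "finite_measure M" "in_L2 M f"
  shows "integrable M (\<lambda>x. norm (f x))"
    and "(\<integral>x. norm (f x) \<partial>M) \<le> sqrt (measure M (space M)) * L2_norm M f"
proof -
  interpret finite_measure M by fact
  have [measurable]: "f \<in> borel_measurable M" and sq: "integrable M (\<lambda>x. (norm (f x))\<^sup>2)"
    using assms(2) by (auto simp: in_L2_def)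
  have "integrable M (\<lambda>x. 1 + (norm (f x))\<^sup>2)" using sq by simp
  then show int: "integrable M (\<lambda>x. norm (f x))"
  proof (rule Bochner_Integration.integrable_bound)
    have "norm (f x) \<le> 1 + (norm (f x))\<^sup>2" for x
      using zero_le_power2[of "norm (f x) - 1"] by (simp add: power2_diff) (use norm_ge_zero[of "f x"] in linarith)
    then show "AE x in M. norm (norm (f x)) \<le> norm (1 + (norm (f x))\<^sup>2)" by simp
  qed simp
  let ?I = "\<integral>x. norm (f x) \<partial>M" and ?J = "\<integral>x. (norm (f x))\<^sup>2 \<partial>M" and ?m = "measure M (space M)"
  have I: "(\<integral>\<^sup>+x. ennreal (norm (f x)) \<partial>M) = ennreal ?I" by (intro nn_integral_eq_integral int) auto
  have J: "(\<integral>\<^sup>+x. ennreal ((norm (f x))\<^sup>2) \<partial>M) = ennreal ?J" by (intro nn_integral_eq_integral sq) auto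
  have "(\<integral>\<^sup>+x. ennreal (norm (f x)) * 1 \<partial>M)\<^sup>2 \<le> (\<integral>\<^sup>+x. (ennreal (norm (f x)))\<^sup>2 \<partial>M) * (\<integral>\<^sup>+x. 1\<^sup>2 \<partial>M)"
    by (rule Cauchy_Schwarz_nn_integral) auto
  then have "ennreal (?I\<^sup>2) \<le> ennreal (?J * ?m)"
    by (simp add: I J emeasure_eq_measure ennreal_power ennreal_mult)
  then have "?I\<^sup>2 \<le> ?m * ?J" by (simp add: ennreal_le_iff mult.commute)
  then have "sqrt (?I\<^sup>2) \<le> sqrt (?m * ?J)" by (rule real_sqrt_le_mono)
  then show "?I \<le> sqrt ?m * L2_norm M f" by (simp add: L2_norm_def real_sqrt_mult)
qed

section \<open>Lipschitz dependence of the boundary pairing on the data\<close>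

lemma norm_scalar_product_le:
  fixes a b :: "complex^3"
  shows "cmod (scalar_product a b) \<le> norm a * norm b"
proof -
  have "cmod (scalar_product a b) \<le> (\<Sum>i\<in>UNIV. \<bar>cmod (a $ i)\<bar> * \<bar>cmod (b $ i)\<bar>)"
    unfolding scalar_product_def by (rule order_trans[OF norm_sum]) (simp add: norm_mult)
  also have "\<dots> \<le> norm a * norm b" unfolding norm_vec_def by (rule L2_set_mult_ineq)
  finally show ?thesis .
qed

lemma scalar_product_diff_right:
  fixes a b c :: "complex^3"
  shows "scalar_product a (b - c) = scalar_product a b - scalar_product a c"
  by (simp add: scalar_product_def sum_subtractf right_diff_distrib)

lemma integrable_scalar_product:
  assumes M: "finite_measure M" and K: "0 \<le> K"
    and a: "a \<in> borel_measurable M" "\<And>x. x \<in> space M \<Longrightarrow> norm (a x) \<le> K"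
    and v: "in_L2 M v"
  shows "integrable M (\<lambda>x. scalar_product (a x) (v x))"
    and "cmod (\<integral>x. scalar_product (a x) (v x) \<partial>M) \<le> K * (sqrt (measure M (space M)) * L2_norm M v)"
proof -
  have vm: "v \<in> borel_measurable M" using v by (simp add: in_L2_def)
  have meas: "(\<lambda>x. scalar_product (a x) (v x)) \<in> borel_measurable M"
    by (intro borel_measurable_continuous_Pair[OF a(1) vm])
      (auto simp: scalar_product_def intro!: continuous_intros)
  have bound: "cmod (scalar_product (a x) (v x)) \<le> K * norm (v x)" if "x \<in> space M" for x
    using norm_scalar_product_le[of "a x" "v x"] mult_right_mono[OF a(2)[OF that] norm_ge_zero[of "v x"]]
    by linarith
  have int: "integrable M (\<lambda>x. K * norm (v x))" using integral_norm_le_L2_norm(1)[OF M v] by simp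
  show i: "integrable M (\<lambda>x. scalar_product (a x) (v x))"
    by (rule Bochner_Integration.integrable_bound[OF int meas])
      (auto intro!: AE_I2 order_trans[OF bound])
  have "cmod (\<integral>x. scalar_product (a x) (v x) \<partial>M) \<le> (\<integral>x. K * norm (v x) \<partial>M)"
    by (rule Bochner_Integration.integral_norm_bound_integral[OF i int bound])
  also have "\<dots> = K * (\<integral>x. norm (v x) \<partial>M)" by simp
  also have "\<dots> \<le> K * (sqrt (measure M (space M)) * L2_norm M v)"
    by (intro mult_left_mono integral_norm_le_L2_norm(2)[OF M v] K)
  finally show "cmod (\<integral>x. scalar_product (a x) (v x) \<partial>M) \<le> K * (sqrt (measure M (space M)) * L2_norm M v)" .
qed

lemma pairing_lipschitz:
  assumes M: "finite_measure M" and a: "bounded_borel M a" and b: "bounded_borel M b"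
  shows "\<exists>K\<ge>0. \<forall>v v' w w'. in_L2 M v \<and> in_L2 M v' \<and> in_L2 M w \<and> in_L2 M w' \<longrightarrow>
    cmod ((\<integral>x. scalar_product (a x) (v x) - scalar_product (b x) (w x) \<partial>M) -
          (\<integral>x. scalar_product (a x) (v' x) - scalar_product (b x) (w' x) \<partial>M))
      \<le> K * (L2_norm M (\<lambda>x. v x - v' x) + L2_norm M (\<lambda>x. w x - w' x))"
proof -
  have am: "a \<in> borel_measurable M" "b \<in> borel_measurable M"
    using a b by (auto simp: bounded_borel_def)
  obtain A where A: "\<And>x. x \<in> space M \<Longrightarrow> norm (a x) \<le> A"
    using a by (auto simp: bounded_borel_def bounded_iff)
  obtain B where B: "\<And>x. x \<in> space M \<Longrightarrow> norm (b x) \<le> B"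
    using b by (auto simp: bounded_borel_def bounded_iff)
  define K where "K = max 0 (max A B)"
  have aK: "norm (a x) \<le> K" "norm (b x) \<le> K" if "x \<in> space M" for x
    using A[OF that] B[OF that] by (auto simp: K_def)
  have K0: "0 \<le> K" by (simp add: K_def)
  let ?m = "sqrt (measure M (space M))"
  show ?thesis
  proof (intro exI[of _ "K * ?m"] conjI allI impI)
    show "0 \<le> K * ?m" by (simp add: K_def)
    fix v v' w w' assume L: "in_L2 M v \<and> in_L2 M v' \<and> in_L2 M w \<and> in_L2 M w'"
    note ia = integrable_scalar_product(1)[OF M K0 am(1) aK(1)]
      and ib = integrable_scalar_product(1)[OF M K0 am(2) aK(2)]
    have dv: "in_L2 M (\<lambda>x. v x - v' x)" and dw: "in_L2 M (\<lambda>x. w x - w' x)"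
      using L by (auto intro: in_L2_diff)
    have eq: "(\<integral>x. scalar_product (a x) (v x) - scalar_product (b x) (w x) \<partial>M) -
          (\<integral>x. scalar_product (a x) (v' x) - scalar_product (b x) (w' x) \<partial>M) =
        (\<integral>x. scalar_product (a x) (v x - v' x) \<partial>M) - (\<integral>x. scalar_product (b x) (w x - w' x) \<partial>M)"
      using L by (simp add: scalar_product_diff_right ia ib)
    show "cmod ((\<integral>x. scalar_product (a x) (v x) - scalar_product (b x) (w x) \<partial>M) -
          (\<integral>x. scalar_product (a x) (v' x) - scalar_product (b x) (w' x) \<partial>M))
      \<le> K * ?m * (L2_norm M (\<lambda>x. v x - v' x) + L2_norm M (\<lambda>x. w x - w' x))"
      unfolding eq
      using norm_triangle_ineq4[of "\<integral>x. scalar_product (a x) (v x - v' x) \<partial>M" "\<integral>x. scalar_product (b x) (w x - w' x) \<partial>M"]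
        integrable_scalar_product(2)[OF M K0 am(1) aK(1) dv] integrable_scalar_product(2)[OF M K0 am(2) aK(2) dw]
      by (simp add: distrib_left mult.assoc)
  qed
qed

text \<open>Both kernels are bounded and measurable: \<open>Im G(\<cdot>, z) a\<close> and its curl are continuous on all of space,
  and the normal is a measurable field of length at most 1.\<close>

lemma boundary_pairing_lipschitz:
  assumes "regular_domain \<Omega>"
  shows "\<exists>K\<ge>0. \<forall>v v' w w'. in_L2 (surface_measure \<Omega>) v \<and> in_L2 (surface_measure \<Omega>) v' \<and>
      in_L2 (surface_measure \<Omega>) w \<and> in_L2 (surface_measure \<Omega>) w' \<longrightarrow>
    cmod (boundary_pairing k \<Omega> a v w z - boundary_pairing k \<Omega> a v' w' z)
      \<le> K * (L2_norm (surface_measure \<Omega>) (\<lambda>x. v x - v' x) + L2_norm (surface_measure \<Omega>) (\<lambda>x. w x - w' x))"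
proof -
  have bd: "bounded \<Omega>" using assms by (auto simp: regular_domain_def bounded_domain_def)
  have G: "continuous_on UNIV (\<lambda>x. Im_green k x z *v a)" "continuous_on UNIV (curl (\<lambda>x. Im_green k x z *v a))"
    using Im_green_column_C1[of k z a] by (auto intro: continuous_on_C1 continuous_on_curl simp del: C_on.simps One_nat_def)
  show ?thesis unfolding boundary_pairing_def
    by (intro pairing_lipschitz finite_measure_surface_measure assms
        bounded_borel_compose[where \<phi> = cvec] bounded_borel_compose2[where \<phi> = cross3]
        bounded_borel_outward_normal bounded_borel_surface_continuous bd
        continuous_on_cvec continuous_on_cross3 G[THEN continuous_on_subset] subset_UNIV)
qed

section \<open>Stability of the imaging functional\<close>

lemma abs_power_diff_le:
  fixes x y R :: real
  assumes "0 \<le> x" "x \<le> R" "0 \<le> y" "y \<le> R"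
  shows "\<bar>x ^ p - y ^ p\<bar> \<le> real p * R ^ (p - 1) * \<bar>x - y\<bar>"
proof -
  have "(\<Sum>i<p. y ^ (p - Suc i) * x ^ i) \<le> (\<Sum>i<p. R ^ (p - 1))"
  proof (rule sum_mono)
    fix i assume "i \<in> {..<p}"
    then have "R ^ (p - 1) = R ^ (p - Suc i) * R ^ i" by (simp flip: power_add)
    then show "y ^ (p - Suc i) * x ^ i \<le> R ^ (p - 1)" using assms by (simp add: mult_mono power_mono)
  qed
  moreover have "0 \<le> (\<Sum>i<p. y ^ (p - Suc i) * x ^ i)" using assms by (intro sum_nonneg) simp
  ultimately show ?thesis
    unfolding power_diff_sumr2 abs_mult by (simp add: mult.commute mult_left_mono)
qed

text \<open>The constant combines the Lipschitz constant \<open>2 K m\<close> of the pairing (the factor 2 because both data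
  contribute at most \<open>max \<delta>\<^sub>1 \<delta>\<^sub>2\<close>) with that of \<open>t \<mapsto> t\<^sup>p\<close> on \<open>[0, X m j + 2 K m]\<close>, an interval that
  contains the noisy value as soon as \<open>max \<delta>\<^sub>1 \<delta>\<^sub>2 < 1\<close>.\<close>

theorem theorem9:
  fixes k :: real
    and D \<Omega> :: "(real^3) set"
    and \<epsilon> :: "real^3 \<Rightarrow> complex^3^3"
    and M N p :: nat
    and d q pol :: "nat \<Rightarrow> real^3"
    and u :: "nat \<Rightarrow> real^3 \<Rightarrow> complex^3"
  assumes "k > 0"
    and "bounded_domain D"
    and "\<epsilon> \<in> borel_measurable lebesgue" and "bounded (range \<epsilon>)"
    and "\<And>x. x \<notin> D \<Longrightarrow> \<epsilon> x = mat 1"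
    and "well_posed k D \<epsilon>"
    and "regular_domain \<Omega>" and "closure D \<subseteq> \<Omega>"
    and "\<And>j. j \<in> {1..N} \<Longrightarrow> d j \<in> sphere 0 1"
    and "\<And>j. j \<in> {1..N} \<Longrightarrow> q j \<bullet> d j = 0"
    and "\<And>j. j \<in> {1..N} \<Longrightarrow> scattered_field k D \<epsilon> (E_in k (q j) (d j)) (u j)"
    and "\<And>m. m \<in> {1..M} \<Longrightarrow> pol m \<in> sphere 0 1"
    and "p \<ge> 1"
  shows "\<forall>z :: real^3. \<exists>C. \<exists>\<delta>\<^sub>0>0. \<forall>\<delta>\<^sub>1 \<delta>\<^sub>2.
    \<forall>(u\<delta> :: nat \<Rightarrow> real^3 \<Rightarrow> complex^3) (w\<delta> :: nat \<Rightarrow> real^3 \<Rightarrow> complex^3).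
      \<delta>\<^sub>1 > 0 \<and> \<delta>\<^sub>2 > 0 \<and> max \<delta>\<^sub>1 \<delta>\<^sub>2 < \<delta>\<^sub>0 \<and>
      (\<forall>j\<in>{1..N}. in_L2 (surface_measure \<Omega>) (u\<delta> j) \<and> in_L2 (surface_measure \<Omega>) (w\<delta> j)) \<and>
      (\<Sum>j=1..N. L2_norm (surface_measure \<Omega>) (\<lambda>x. u j x - u\<delta> j x)) \<le> \<delta>\<^sub>1 \<and>
      (\<Sum>j=1..N. L2_norm (surface_measure \<Omega>) (\<lambda>x. curl_trace \<Omega> (u j) x - w\<delta> j x)) \<le> \<delta>\<^sub>2
      \<longrightarrow> \<bar>imaging k \<Omega> M N pol p u (\<lambda>j. curl_trace \<Omega> (u j)) z - imaging k \<Omega> M N pol p u\<delta> w\<delta> z\<bar>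
            \<le> C * max \<delta>\<^sub>1 \<delta>\<^sub>2"
proof
  fix z :: "real^3"
  let ?S = "surface_measure \<Omega>"
  have bd: "bounded \<Omega>" "open \<Omega>"
    using assms(7) by (auto simp: regular_domain_def bounded_domain_def)
  have fin: "finite_measure ?S" by (rule finite_measure_surface_measure[OF assms(7)])
  have out: "frontier \<Omega> \<subseteq> - closure D"
    using assms(8) bd(2) by (auto simp: frontier_def interior_open)
  have data: "in_L2 ?S (u j)" "in_L2 ?S (curl_trace \<Omega> (u j))" if "j \<in> {1..N}" for j
  proof -
    have C1: "C_on 1 (- closure D) (u j)" using assms(11)[OF that] by (simp only: scattered_field_def)
    have "open (- closure D)" by (simp add: open_Compl)
    from continuous_on_subset[OF continuous_on_curl[OF this C1] out]
    show "in_L2 ?S (curl_trace \<Omega> (u j))"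
      by (rule in_L2_bounded_borel[OF fin bounded_borel_curl_trace[OF bd(1)]])
    from continuous_on_subset[OF continuous_on_C1[OF C1] out]
    show "in_L2 ?S (u j)"
      by (rule in_L2_bounded_borel[OF fin bounded_borel_surface_continuous[OF bd(1)]])
  qed
  define Lipschitz where "Lipschitz m K \<longleftrightarrow> K \<ge> 0 \<and>
    (\<forall>v v' w w'. in_L2 ?S v \<and> in_L2 ?S v' \<and> in_L2 ?S w \<and> in_L2 ?S w' \<longrightarrow>
      cmod (boundary_pairing k \<Omega> (pol m) v w z - boundary_pairing k \<Omega> (pol m) v' w' z)
        \<le> K * (L2_norm ?S (\<lambda>x. v x - v' x) + L2_norm ?S (\<lambda>x. w x - w' x)))" for m K
  have "\<exists>K. Lipschitz m K" for m
    unfolding Lipschitz_def by (rule boundary_pairing_lipschitz[OF assms(7)])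
  then obtain K where "\<And>m. Lipschitz m (K m)" by metis
  then have K: "K m \<ge> 0" "in_L2 ?S v \<and> in_L2 ?S v' \<and> in_L2 ?S w \<and> in_L2 ?S w' \<Longrightarrow>
      cmod (boundary_pairing k \<Omega> (pol m) v w z - boundary_pairing k \<Omega> (pol m) v' w' z)
        \<le> K m * (L2_norm ?S (\<lambda>x. v x - v' x) + L2_norm ?S (\<lambda>x. w x - w' x))" for m v v' w w'
    unfolding Lipschitz_def by blast+
  define X where "X m j = cmod (boundary_pairing k \<Omega> (pol m) (u j) (curl_trace \<Omega> (u j)) z)" for m j
  define c where "c m j = real p * (X m j + 2 * K m) ^ (p - 1) * (2 * K m)" for m j
  define C where "C = (\<Sum>m=1..M. \<Sum>j=1..N. c m j)"
  show "\<exists>C. \<exists>\<delta>\<^sub>0>0. \<forall>\<delta>\<^sub>1 \<delta>\<^sub>2.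
    \<forall>(u\<delta> :: nat \<Rightarrow> real^3 \<Rightarrow> complex^3) (w\<delta> :: nat \<Rightarrow> real^3 \<Rightarrow> complex^3).
      \<delta>\<^sub>1 > 0 \<and> \<delta>\<^sub>2 > 0 \<and> max \<delta>\<^sub>1 \<delta>\<^sub>2 < \<delta>\<^sub>0 \<and>
      (\<forall>j\<in>{1..N}. in_L2 ?S (u\<delta> j) \<and> in_L2 ?S (w\<delta> j)) \<and>
      (\<Sum>j=1..N. L2_norm ?S (\<lambda>x. u j x - u\<delta> j x)) \<le> \<delta>\<^sub>1 \<and>
      (\<Sum>j=1..N. L2_norm ?S (\<lambda>x. curl_trace \<Omega> (u j) x - w\<delta> j x)) \<le> \<delta>\<^sub>2
      \<longrightarrow> \<bar>imaging k \<Omega> M N pol p u (\<lambda>j. curl_trace \<Omega> (u j)) z - imaging k \<Omega> M N pol p u\<delta> w\<delta> z\<bar>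
            \<le> C * max \<delta>\<^sub>1 \<delta>\<^sub>2"
  proof (rule exI[of _ C], rule exI[of _ 1], intro conjI allI impI, simp, elim conjE)
    fix \<delta>\<^sub>1 \<delta>\<^sub>2 :: real and u\<delta> w\<delta> :: "nat \<Rightarrow> real^3 \<Rightarrow> complex^3"
    assume pos: "\<delta>\<^sub>1 > 0" "\<delta>\<^sub>2 > 0" and small: "max \<delta>\<^sub>1 \<delta>\<^sub>2 < 1"
      and noisy: "\<forall>j\<in>{1..N}. in_L2 ?S (u\<delta> j) \<and> in_L2 ?S (w\<delta> j)"
      and e1: "(\<Sum>j=1..N. L2_norm ?S (\<lambda>x. u j x - u\<delta> j x)) \<le> \<delta>\<^sub>1"
      and e2: "(\<Sum>j=1..N. L2_norm ?S (\<lambda>x. curl_trace \<Omega> (u j) x - w\<delta> j x)) \<le> \<delta>\<^sub>2"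
    define \<delta> where "\<delta> = max \<delta>\<^sub>1 \<delta>\<^sub>2"
    define Y where "Y m j = cmod (boundary_pairing k \<Omega> (pol m) (u\<delta> j) (w\<delta> j) z)" for m j
    have \<delta>: "0 \<le> \<delta>" "\<delta> \<le> 1" "\<delta>\<^sub>1 \<le> \<delta>" "\<delta>\<^sub>2 \<le> \<delta>" using pos small by (auto simp: \<delta>_def)
    have nn: "0 \<le> L2_norm ?S f" for f by (simp add: L2_norm_def)
    have term_le: "\<bar>X m j ^ p - Y m j ^ p\<bar> \<le> c m j * \<delta>" if j: "j \<in> {1..N}" for m j
    proof -
      have "L2_norm ?S (\<lambda>x. u j x - u\<delta> j x) \<le> \<delta>"
        using member_le_sum[of j "{1..N}" "\<lambda>j. L2_norm ?S (\<lambda>x. u j x - u\<delta> j x)"] j nn e1 \<delta>(3) by force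
      moreover have "L2_norm ?S (\<lambda>x. curl_trace \<Omega> (u j) x - w\<delta> j x) \<le> \<delta>"
        using member_le_sum[of j "{1..N}" "\<lambda>j. L2_norm ?S (\<lambda>x. curl_trace \<Omega> (u j) x - w\<delta> j x)"] j nn e2 \<delta>(4) by force
      ultimately have s: "L2_norm ?S (\<lambda>x. u j x - u\<delta> j x) + L2_norm ?S (\<lambda>x. curl_trace \<Omega> (u j) x - w\<delta> j x) \<le> 2 * \<delta>"
        by linarith
      have "\<bar>X m j - Y m j\<bar> \<le> K m * (L2_norm ?S (\<lambda>x. u j x - u\<delta> j x) +
          L2_norm ?S (\<lambda>x. curl_trace \<Omega> (u j) x - w\<delta> j x))"
        unfolding X_def Y_def using data[OF j] noisy j
        by (intro order_trans[OF norm_triangle_ineq3 K(2)]) blast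
      also have "\<dots> \<le> K m * (2 * \<delta>)" by (rule mult_left_mono[OF s K(1)])
      finally have d: "\<bar>X m j - Y m j\<bar> \<le> 2 * K m * \<delta>" by simp
      also have "\<dots> \<le> 2 * K m" using \<delta>(2) K(1)[of m] by (simp add: mult_left_le)
      finally have "Y m j \<le> X m j + 2 * K m" by linarith
      then have "\<bar>X m j ^ p - Y m j ^ p\<bar> \<le> real p * (X m j + 2 * K m) ^ (p - 1) * \<bar>X m j - Y m j\<bar>"
        using K(1)[of m] by (intro abs_power_diff_le) (auto simp: X_def Y_def)
      also have "\<dots> \<le> real p * (X m j + 2 * K m) ^ (p - 1) * (2 * K m * \<delta>)"
        using K(1)[of m] by (intro mult_left_mono d) (simp add: X_def)
      finally show ?thesis by (simp add: c_def mult.assoc)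
    qed
    have "\<bar>imaging k \<Omega> M N pol p u (\<lambda>j. curl_trace \<Omega> (u j)) z - imaging k \<Omega> M N pol p u\<delta> w\<delta> z\<bar> =
        \<bar>\<Sum>m=1..M. \<Sum>j=1..N. X m j ^ p - Y m j ^ p\<bar>"
      by (simp add: imaging_def X_def Y_def sum_subtractf)
    also have "\<dots> \<le> (\<Sum>m=1..M. \<Sum>j=1..N. \<bar>X m j ^ p - Y m j ^ p\<bar>)"
      by (intro order_trans[OF sum_abs] sum_mono sum_abs)
    also have "\<dots> \<le> (\<Sum>m=1..M. \<Sum>j=1..N. c m j * \<delta>)"
      by (intro sum_mono term_le)
    also have "\<dots> = C * \<delta>" by (simp add: C_def sum_distrib_right)
    finally show "\<bar>imaging k \<Omega> M N pol p u (\<lambda>j. curl_trace \<Omega> (u j)) z - imaging k \<Omega> M N pol p u\<delta> w\<delta> z\<bar>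
            \<le> C * max \<delta>\<^sub>1 \<delta>\<^sub>2" by (simp only: \<delta>_def)
  qed
qed

end
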